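(* Let $X$ be a path-connected space and $x_0\in X$. If a subgroup $H\leq\pi_1(X,x_0)$ is $(C,c_\tau)$-closed, then $H$ is $(C,c_\infty)$-closed. The converse holds if $H$ is a normal subgroup of $\pi_1(X,x_0)$. In particular, the closure operators $cl_{C,c_\infty}$ and $cl_{C,c_\tau}$ agree on normal subgroups of $\pi_1(X,x_0)$.
   Context: A map is a continuous function; $f_{\#}$ denotes the homomorphism induced on fundamental groups. For paths, $\alpha\cdot\beta$ is concatenation and $\alpha^{-}(t)=\alpha(1-t)$. Closed subgroups and closure: for a based space $(\mathbb{T},t_0)$, a subgroup $T\leq\pi_1(\mathbb{T},t_0)$ and $g\in\pi_1(\mathbb{T},t_0)$, a subgroup $H\leq\pi_1(X,x_0)$ is $(T,g)$-closed if for every map $f:(\mathbb{T},t_0)\to(X,x_0)$ with $f_{\#}(T)\leq H$ we have $f_{\#}(g)\in H$. The $(T,g)$-closure $cl_{T,g}(H)$ is the intersection of all $(T,g)$-closed subgroups of $\pi_1(X,x_0)$ containing $H$. The test space $\mathbb{H}^+$: let $C_n\subseteq\mathbb{R}^2$ be the circle of radius $\frac1n$ centered at $(\frac1n,0)$, $\mathbb{H}=\bigcup_{n\geq1}C_n$, $b_0=(0,0)$, and $\mathbb{H}^+=\mathbb{H}\cup([-1,0]\times\{0\})$ with basepoint $b_0^+=(-1,0)$. Let $\ell_n$ be the loop based at $b_0$ traversing $C_n$ once counterclockwise, and $\ell_\infty:[0,1]\to\mathbb{H}$ the loop that is $\ell_n$ (linearly reparametrized) on $[\frac{n-1}{n},\frac{n}{n+1}]$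 for each $n\geq1$, with $\ell_\infty(1)=b_0$. Let $\mathcal{C}\subseteq[0,1]$ be the standard middle third Cantor set and write $[0,1]\setminus\mathcal{C}=\bigcup_{n\geq1}\bigcup_{k=1}^{2^{n-1}}I_n^k$, where $I_n^k$ are the components of length $\frac{1}{3^n}$, indexed by $k$ in their natural order. Let $\ell_\tau:[0,1]\to\mathbb{H}$ be the loop with $\ell_\tau(\mathcal{C})=\{b_0\}$ and equal to $\ell_{2^{n-1}+k-1}$ (linearly reparametrized) on $\overline{I_n^k}$. Let $\iota:[0,1]\to\mathbb{H}^+$, $\iota(t)=(t-1,0)$. Put $c_n=[\iota\cdot\ell_n\cdot\iota^{-}]$, $C=\langle c_n\mid n\in\mathbb{N}\rangle\leq\pi_1(\mathbb{H}^+,b_0^+)$, $c_\infty=[\iota\cdot\ell_\infty\cdot\iota^{-}]$, and $c_\tau=[\iota\cdot\ell_\tau\cdot\iota^{-}]$. *)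

theory Defs
  imports "HOL-Analysis.Analysis" "HOL-Algebra.Generated_Groups" "HOL-Algebra.Coset"
begin

section \<open>Fundamental groups\<close>

definition loops_at :: "'a::topological_space set \<Rightarrow> 'a \<Rightarrow> (real \<Rightarrow> 'a) set" where
  "loops_at X x0 = {p. path p \<and> path_image p \<subseteq> X \<and> pathstart p = x0 \<and> pathfinish p = x0}"

text \<open>Paths are total functions on the reals; homotopic_paths ignores the values outside of the
  unit interval.\<close>

definition path_class :: "'a::topological_space set \<Rightarrow> (real \<Rightarrow> 'a) \<Rightarrow> (real \<Rightarrow> 'a) set" where
  "path_class X p = {q. homotopic_paths X p q}"

definition pi1 :: "'a::topological_space set \<Rightarrow> 'a \<Rightarrow> (real \<Rightarrow> 'a) set monoid" where
  "pi1 X x0 =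
     \<lparr>carrier = path_class X ` loops_at X x0,
      monoid.mult = (\<lambda>a b. \<Union>p\<in>a. \<Union>q\<in>b. path_class X (p +++ q)),
      one = path_class X (\<lambda>t. x0)\<rparr>"

definition based_map ::
  "'b::topological_space set \<Rightarrow> 'b \<Rightarrow> 'a::topological_space set \<Rightarrow> 'a \<Rightarrow> ('b \<Rightarrow> 'a) \<Rightarrow> bool" where
  "based_map T t0 X x0 f \<longleftrightarrow> continuous_on T f \<and> f \<in> T \<rightarrow> X \<and> f t0 = x0"

text \<open>The homomorphism induced by a map f into X, on path classes.\<close>

definition induced ::
  "'a::topological_space set \<Rightarrow> ('b::topological_space \<Rightarrow> 'a) \<Rightarrow> (real \<Rightarrow> 'b) set \<Rightarrow> (real \<Rightarrow> 'a) set" where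
  "induced X f a = (\<Union>p\<in>a. path_class X (f \<circ> p))"


section \<open>Closed subgroups and closure\<close>

text \<open>The test data are the based space (Tsp, t0), the subgroup T of its fundamental group and the
  element g.\<close>

definition test_closed ::
  "'b::topological_space set \<Rightarrow> 'b \<Rightarrow> (real \<Rightarrow> 'b) set set \<Rightarrow> (real \<Rightarrow> 'b) set \<Rightarrow>
   'a::topological_space set \<Rightarrow> 'a \<Rightarrow> (real \<Rightarrow> 'a) set set \<Rightarrow> bool" where
  "test_closed Tsp t0 T g X x0 H \<longleftrightarrow>
     subgroup H (pi1 X x0) \<and>
     (\<forall>f. based_map Tsp t0 X x0 f \<longrightarrow> induced X f ` T \<subseteq> H \<longrightarrow> induced X f g \<in> H)"

definition test_closure ::
  "'b::topological_space set \<Rightarrow> 'b \<Rightarrow> (real \<Rightarrow> 'b) set set \<Rightarrow> (real \<Rightarrow> 'b) set \<Rightarrow>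
   'a::topological_space set \<Rightarrow> 'a \<Rightarrow> (real \<Rightarrow> 'a) set set \<Rightarrow> (real \<Rightarrow> 'a) set set" where
  "test_closure Tsp t0 T g X x0 H = \<Inter>{K. test_closed Tsp t0 T g X x0 K \<and> H \<subseteq> K}"


section \<open>The Hawaiian earring with a whisker\<close>

definition hcircle :: "nat \<Rightarrow> (real \<times> real) set" where
  "hcircle n = sphere (1 / real n, 0) (1 / real n)"

definition earring :: "(real \<times> real) set" where
  "earring = (\<Union>n\<in>{1..}. hcircle n)"

definition earring_plus :: "(real \<times> real) set" where
  "earring_plus = earring \<union> {-1..0} \<times> {0}"

definition b0 :: "real \<times> real" where "b0 = (0, 0)"

definition b0_plus :: "real \<times> real" where "b0_plus = (-1, 0)"

text \<open>Seen from the centre of the n-th circle, the origin lies at angle pi.\<close>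

definition ell :: "nat \<Rightarrow> real \<Rightarrow> real \<times> real" where
  "ell n t = (1 / real n + cos (pi + 2 * pi * t) / real n, sin (pi + 2 * pi * t) / real n)"

definition ell_inf :: "real \<Rightarrow> real \<times> real" where
  "ell_inf t =
     (if 0 \<le> t \<and> t < 1 then
        let n = (THE n. 1 \<le> n \<and> (real n - 1) / real n \<le> t \<and> t < real n / (real n + 1));
            a = (real n - 1) / real n; b = real n / (real n + 1)
        in ell n ((t - a) / (b - a))
      else b0)"


section \<open>The Cantor set and its gaps\<close>

fun cantor_stage :: "nat \<Rightarrow> real set" where
  "cantor_stage 0 = {0..1}"
| "cantor_stage (Suc m) = (\<lambda>x. x / 3) ` cantor_stage m \<union> (\<lambda>x. 2 / 3 + x / 3) ` cantor_stage m"

definition cantor_set :: "real set" where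
  "cantor_set = (\<Inter>m. cantor_stage m)"

definition cantor_gaps :: "nat \<Rightarrow> real set set" where
  "cantor_gaps n = {I \<in> components ({0..1} - cantor_set). Sup I - Inf I = 1 / 3 ^ n}"

text \<open>The k-th gap (counted from 1) of length 1 / 3 ^ n, from left to right.\<close>

definition cantor_gap :: "nat \<Rightarrow> nat \<Rightarrow> real set" where
  "cantor_gap n k =
     (THE I. I \<in> cantor_gaps n \<and> card {J \<in> cantor_gaps n. Inf J \<le> Inf I} = k)"

definition ell_tau :: "real \<Rightarrow> real \<times> real" where
  "ell_tau t =
     (if t \<in> {0..1} - cantor_set then
        let (n, k) = (THE (n, k). 1 \<le> n \<and> 1 \<le> k \<and> k \<le> 2 ^ (n - 1) \<and> t \<in> cantor_gap n k);
            a = Inf (cantor_gap n k); b = Sup (cantor_gap n k)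
        in ell (2 ^ (n - 1) + k - 1) ((t - a) / (b - a))
      else b0)"


section \<open>The test subgroup and the test elements\<close>

definition whisker :: "real \<Rightarrow> real \<times> real" where
  "whisker t = (t - 1, 0)"

definition whiskered :: "(real \<Rightarrow> real \<times> real) \<Rightarrow> (real \<Rightarrow> real \<times> real) set" where
  "whiskered p = path_class earring_plus (whisker +++ p +++ reversepath whisker)"

definition c_elem :: "nat \<Rightarrow> (real \<Rightarrow> real \<times> real) set" where
  "c_elem n = whiskered (ell n)"

definition C_sub :: "(real \<Rightarrow> real \<times> real) set set" where
  "C_sub = generate (pi1 earring_plus b0_plus) (c_elem ` {1..})"

definition c_inf :: "(real \<Rightarrow> real \<times> real) set" where
  "c_inf = whiskered ell_inf"

definition c_tau :: "(real \<Rightarrow> real \<times> real) set" where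
  "c_tau = whiskered ell_tau"

abbreviation Cinf_closed ::
  "'a::topological_space set \<Rightarrow> 'a \<Rightarrow> (real \<Rightarrow> 'a) set set \<Rightarrow> bool" where
  "Cinf_closed \<equiv> test_closed earring_plus b0_plus C_sub c_inf"

abbreviation Ctau_closed ::
  "'a::topological_space set \<Rightarrow> 'a \<Rightarrow> (real \<Rightarrow> 'a) set set \<Rightarrow> bool" where
  "Ctau_closed \<equiv> test_closed earring_plus b0_plus C_sub c_tau"

abbreviation cl_Cinf ::
  "'a::topological_space set \<Rightarrow> 'a \<Rightarrow> (real \<Rightarrow> 'a) set set \<Rightarrow> (real \<Rightarrow> 'a) set set" where
  "cl_Cinf \<equiv> test_closure earring_plus b0_plus C_sub c_inf"

abbreviation cl_Ctau ::
  "'a::topological_space set \<Rightarrow> 'a \<Rightarrow> (real \<Rightarrow> 'a) set set \<Rightarrow> (real \<Rightarrow> 'a) set set" where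
  "cl_Ctau \<equiv> test_closure earring_plus b0_plus C_sub c_tau"

end

theory Submission
  imports Defs
begin

text \<open>
  A map from the earring with its whisker into X is the same thing as a path \<open>\<sigma>\<close> from the base point
  together with a map \<open>g\<close> of the earring itself that takes \<open>b0\<close> to the end of \<open>\<sigma>\<close> (\<open>test_closed_iff\<close>). A loop \<open>p\<close> in the earring then
  contributes the class of \<open>\<sigma> \<cdot> (g \<circ> p) \<cdot> \<sigma>\<^sup>-\<close>, and a subgroup is closed for the test element given by \<open>p\<close>
  if it contains this class as soon as it contains the classes given by all the circles \<open>ell n\<close>.
  So one may change a test map either by composing \<open>g\<close> with a self-map of the earring or by
  prolonging \<open>\<sigma>\<close>. Self-maps of the earring are plentiful: any null sequence of loops
  may be prescribed on the circles (\<open>earring_self_map_exists\<close>).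

  From \<open>\<tau>\<close> to \<open>\<infinity>\<close>: among the gaps of the Cantor set, the rightmost gaps of the various lengths occur
  in increasing order. The self-map that sends the circles attached to these gaps to the successive
  circles of the earring and collapses all others turns \<open>ell_tau\<close> into a reparametrization
  of \<open>ell_inf\<close> (\<open>ell_inf_as_image_of_ell_tau\<close>), and it maps every generator to a generator or to the
  identity.

  From \<open>\<infinity>\<close> to \<open>\<tau>\<close>, for a normal subgroup: let \<open>\<beta> n\<close> be \<open>ell_tau\<close> with the circles of index less than \<open>n\<close>
  collapsed. Passing from \<open>\<beta> n\<close> to \<open>\<beta> (n + 1)\<close> deletes a single occurrence of \<open>ell n\<close>, so
  \<open>\<beta> n \<cdot> (\<beta> (n + 1))\<^sup>-\<close> is a conjugate of \<open>ell n\<close>; its class lies in the subgroup by normality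
  (\<open>tail_concat_step\<close>). These loops shrink to the base point, so a self-map of the earring sends \<open>ell n\<close>
  to \<open>\<beta> n \<cdot> (\<beta> (n + 1))\<^sup>-\<close>, and \<open>ell_inf\<close> is sent to the infinite product of all of them, which telescopes
  to \<open>\<beta> 1 = ell_tau\<close> (\<open>telescoping_product\<close>).

  For the closure operators, the subgroups over which one intersects need not be normal. But
  prolonging \<open>\<sigma>\<close> by a loop conjugates all classes simultaneously, so conjugates of closed subgroups are
  closed, and the closure of a normal subgroup is again normal (\<open>test_closure_normal\<close>). Hence the
  \<open>\<infinity>\<close>-closure of a normal subgroup is also \<open>\<tau>\<close>-closed.
\<close>

section \<open>Homotopies of paths and the fundamental group\<close>

lemma homotopic_paths_const_join:
  fixes p :: "real \<Rightarrow> 'a::topological_space"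
  assumes "path p" "path_image p \<subseteq> S" "pathstart p = x"
  shows "homotopic_paths S ((\<lambda>t. x) +++ p) p"
proof (rule homotopic_paths_sym, rule homotopic_paths_reparametrize[OF assms(1,2), where f = "\<lambda>t. max (2 * t - 1) 0"])
  show "continuous_on {0..1} (\<lambda>t::real. max (2 * t - 1) 0)" by (intro continuous_intros)
qed (use assms(3) in \<open>auto simp: joinpaths_def pathstart_def max_def\<close>)

text \<open>The product of a path with its reverse is the image under the path of a back-and-forth walk in the
  unit interval, which contracts linearly. This makes the argument independent of any linear structure
  on the space; for the same reason constant paths are written as constant functions.\<close>

lemma homotopic_paths_join_reversepath:
  fixes p :: "real \<Rightarrow> 'a::topological_space"
  assumes "path p" "path_image p \<subseteq> S"
  shows "homotopic_paths S (p +++ reversepath p) (\<lambda>t. pathstart p)"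
proof -
  have "homotopic_paths {0..1} ((\<lambda>t. t) +++ reversepath (\<lambda>t. t)) (linepath 0 (0::real))"
    using homotopic_paths_rinv[of "\<lambda>t::real. t" "{0..1}"]
    by (simp add: path_def path_image_def pathstart_def continuous_on_id)
  then have "homotopic_paths S (p \<circ> ((\<lambda>t. t) +++ reversepath (\<lambda>t. t))) (p \<circ> linepath 0 (0::real))"
    by (rule homotopic_paths_continuous_image) (use assms in \<open>auto simp: path_def path_image_def\<close>)
  moreover have "p \<circ> ((\<lambda>t. t) +++ reversepath (\<lambda>t. t)) = p +++ reversepath p"
    by (auto simp: joinpaths_def reversepath_def)
  moreover have "p \<circ> linepath 0 (0::real) = (\<lambda>t. pathstart p)"
    by (auto simp: linepath_def pathstart_def)
  ultimately show ?thesis by simp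
qed

lemma homotopic_paths_reversepath_join:
  fixes p :: "real \<Rightarrow> 'a::topological_space"
  assumes "path p" "path_image p \<subseteq> S"
  shows "homotopic_paths S (reversepath p +++ p) (\<lambda>t. pathfinish p)"
  using homotopic_paths_join_reversepath[of "reversepath p" S] assms by simp

lemma path_class_eqI: "homotopic_paths X p q \<Longrightarrow> path_class X p = path_class X q"
  unfolding path_class_def by (auto intro: homotopic_paths_trans homotopic_paths_sym)

lemma const_path_simps [simp]: "path (\<lambda>t. x)" "path_image (\<lambda>t. x) = {x}" "pathstart (\<lambda>t. x) = x"
  "pathfinish (\<lambda>t. x) = x" "reversepath (\<lambda>t. x) = (\<lambda>t. x)" 
  by (auto simp: path_def path_image_def pathstart_def pathfinish_def reversepath_def)

lemma loops_at_join: "p \<in> loops_at X x \<Longrightarrow> q \<in> loops_at X x \<Longrightarrow> p +++ q \<in> loops_at X x"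
  by (auto simp: loops_at_def path_image_join)

lemma loops_at_reversepath: "p \<in> loops_at X x \<Longrightarrow> reversepath p \<in> loops_at X x"
  by (auto simp: loops_at_def)

lemma loops_at_const: "x \<in> X \<Longrightarrow> (\<lambda>t. x) \<in> loops_at X x"
  by (auto simp: loops_at_def)

lemma path_class_in_carrier: "p \<in> loops_at X x \<Longrightarrow> path_class X p \<in> carrier (pi1 X x)"
  by (simp add: pi1_def)

lemma carrier_pi1: "carrier (pi1 X x) = path_class X ` loops_at X x"
  by (simp add: pi1_def)

lemma one_pi1: "\<one>\<^bsub>pi1 X x\<^esub> = path_class X (\<lambda>t. x)"
  by (simp add: pi1_def)

lemma mult_pi1:
  assumes "p \<in> loops_at X x" "q \<in> loops_at X x"
  shows "path_class X p \<otimes>\<^bsub>pi1 X x\<^esub> path_class X q = path_class X (p +++ q)"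
proof -
  have "path_class X (p' +++ q') = path_class X (p +++ q)"
    if "p' \<in> path_class X p" "q' \<in> path_class X q" for p' q'
    using that assms unfolding path_class_def[of X p] path_class_def[of X q] loops_at_def
    by (intro path_class_eqI homotopic_paths_sym[OF homotopic_paths_join]) auto
  note * = this
  have "p \<in> path_class X p" "q \<in> path_class X q"
    using assms by (auto simp: path_class_def loops_at_def)
  then have "(\<Union>p'\<in>path_class X p. \<Union>q'\<in>path_class X q. path_class X (p' +++ q')) = path_class X (p +++ q)"
    by (intro SUP_eq_const *) blast+
  then show ?thesis by (simp add: pi1_def)
qed

lemma group_pi1:
  assumes "x \<in> X"
  shows "group (pi1 X x)"
proof (rule groupI)
  show "a \<otimes>\<^bsub>pi1 X x\<^esub> b \<in> carrier (pi1 X x)"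
    if "a \<in> carrier (pi1 X x)" "b \<in> carrier (pi1 X x)" for a b
    using that by (auto simp: mult_pi1 carrier_pi1 loops_at_join)
  show "\<one>\<^bsub>pi1 X x\<^esub> \<in> carrier (pi1 X x)"
    by (simp add: one_pi1 path_class_in_carrier loops_at_const assms)
  show "a \<otimes>\<^bsub>pi1 X x\<^esub> b \<otimes>\<^bsub>pi1 X x\<^esub> c = a \<otimes>\<^bsub>pi1 X x\<^esub> (b \<otimes>\<^bsub>pi1 X x\<^esub> c)"
    if abc: "a \<in> carrier (pi1 X x)" "b \<in> carrier (pi1 X x)" "c \<in> carrier (pi1 X x)" for a b c
  proof -
    obtain p q r where pqr: "p \<in> loops_at X x" "q \<in> loops_at X x" "r \<in> loops_at X x"
      and "a = path_class X p" "b = path_class X q" "c = path_class X r"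
      using abc unfolding carrier_pi1 by blast
    moreover have "path_class X ((p +++ q) +++ r) = path_class X (p +++ (q +++ r))"
      using pqr by (intro path_class_eqI homotopic_paths_sym[OF homotopic_paths_assoc]) (auto simp: loops_at_def)
    ultimately show ?thesis by (simp add: mult_pi1 loops_at_join)
  qed
  show "\<one>\<^bsub>pi1 X x\<^esub> \<otimes>\<^bsub>pi1 X x\<^esub> a = a" if a: "a \<in> carrier (pi1 X x)" for a
  proof -
    obtain p where "p \<in> loops_at X x" "a = path_class X p"
      using a unfolding carrier_pi1 by blast
    moreover from this have "path_class X ((\<lambda>t. x) +++ p) = path_class X p"
      by (intro path_class_eqI homotopic_paths_const_join) (auto simp: loops_at_def)
    ultimately show ?thesis by (simp add: one_pi1 mult_pi1 loops_at_const assms)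
  qed
  show "\<exists>b\<in>carrier (pi1 X x). b \<otimes>\<^bsub>pi1 X x\<^esub> a = \<one>\<^bsub>pi1 X x\<^esub>" if a: "a \<in> carrier (pi1 X x)" for a
  proof -
    obtain p where p: "p \<in> loops_at X x" "a = path_class X p"
      using a unfolding carrier_pi1 by blast
    have "path_class X (reversepath p +++ p) = path_class X (\<lambda>t. x)"
      using p homotopic_paths_reversepath_join[of p X]
      by (intro path_class_eqI) (auto simp: loops_at_def)
    with p show ?thesis
      by (intro bexI[of _ "path_class X (reversepath p)"])
        (auto simp: one_pi1 mult_pi1 loops_at_reversepath path_class_in_carrier)
  qed
qed

lemma inv_pi1:
  assumes "p \<in> loops_at X x"
  shows "inv\<^bsub>pi1 X x\<^esub> path_class X p = path_class X (reversepath p)"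
proof -
  have "x \<in> X" using assms by (auto simp: loops_at_def)
  have "path_class X (reversepath p +++ p) = path_class X (\<lambda>t. x)"
    using assms homotopic_paths_reversepath_join[of p X]
    by (intro path_class_eqI) (auto simp: loops_at_def)
  then show ?thesis
    using assms by (intro group.inv_equality[OF group_pi1[OF \<open>x \<in> X\<close>]])
      (auto simp: mult_pi1 one_pi1 loops_at_reversepath path_class_in_carrier)
qed

lemma induced_path_class:
  assumes "continuous_on T f" "f \<in> T \<rightarrow> X" "path p" "path_image p \<subseteq> T"
  shows "induced X f (path_class T p) = path_class X (f \<circ> p)"
proof -
  have "path_class X (f \<circ> q) = path_class X (f \<circ> p)" if "q \<in> path_class T p" for q
    using that assms unfolding path_class_def[of T]
    by (intro path_class_eqI homotopic_paths_sym[OF homotopic_paths_continuous_image]) auto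
  note * = this
  have "p \<in> path_class T p" using assms by (simp add: path_class_def)
  then show ?thesis unfolding induced_def by (intro SUP_eq_const *) blast+
qed

lemma joinpaths_o: "f \<circ> (p +++ q) = (f \<circ> p) +++ (f \<circ> q)"
  by (auto simp: joinpaths_def)

lemma o_reversepath: "f \<circ> reversepath p = reversepath (f \<circ> p)"
  by (auto simp: reversepath_def)

lemma loops_at_compose:
  assumes "p \<in> loops_at T t" "based_map T t X x f"
  shows "f \<circ> p \<in> loops_at X x"
proof -
  have "path (f \<circ> p)"
    using assms by (intro path_continuous_image) (auto simp: loops_at_def based_map_def intro: continuous_on_subset)
  then show ?thesis
    using assms unfolding loops_at_def based_map_def
    by (auto simp: path_image_compose pathstart_compose pathfinish_compose)
qed

text \<open>Since a based map induces a homomorphism, whether it carries a generated subgroup into a subgroup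
  can be tested on generators; this is how the subgroup C enters only through the circles.\<close>

lemma induced_generate_subset:
  assumes f: "based_map T t X x f" and t: "t \<in> T"
    and S: "S \<subseteq> carrier (pi1 T t)" and H: "subgroup H (pi1 X x)"
    and gens: "induced X f ` S \<subseteq> H"
  shows "induced X f ` generate (pi1 T t) S \<subseteq> H"
proof (clarify, erule generate.induct)
  have ind: "induced X f (path_class T p) = path_class X (f \<circ> p)" if "p \<in> loops_at T t" for p
    using that f by (intro induced_path_class) (auto simp: based_map_def loops_at_def)
  have lp: "f \<circ> p \<in> loops_at X x" if "p \<in> loops_at T t" for p
    using that f by (rule loops_at_compose)
  have G: "group (pi1 T t)" by (rule group_pi1[OF t])
  show "induced X f \<one>\<^bsub>pi1 T t\<^esub> \<in> H"
    using subgroup.one_closed[OF H] f t ind[OF loops_at_const[OF t]]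
    by (simp add: one_pi1 o_def based_map_def)
  show "induced X f s \<in> H" if "s \<in> S" for s using that gens by auto
  show "induced X f (inv\<^bsub>pi1 T t\<^esub> s) \<in> H" if s: "s \<in> S" for s
  proof -
    obtain p where p: "p \<in> loops_at T t" "s = path_class T p"
      using s S unfolding carrier_pi1 by blast
    have "path_class X (reversepath (f \<circ> p)) \<in> H"
      using s gens p subgroup.m_inv_closed[OF H, of "path_class X (f \<circ> p)"]
      by (auto simp: ind inv_pi1[OF lp[OF p(1)]])
    then show ?thesis using p by (simp add: inv_pi1 ind loops_at_reversepath o_reversepath)
  qed
  fix a b assume ab: "a \<in> generate (pi1 T t) S" "induced X f a \<in> H" 
      "b \<in> generate (pi1 T t) S" "induced X f b \<in> H"
  then have "a \<in> carrier (pi1 T t)" "b \<in> carrier (pi1 T t)"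
    using group.generate_in_carrier[OF G S] by auto
  then obtain p q where pq: "p \<in> loops_at T t" "a = path_class T p" "q \<in> loops_at T t" "b = path_class T q"
    unfolding carrier_pi1 by blast
  have "path_class X ((f \<circ> p) +++ (f \<circ> q)) \<in> H"
    using ab pq subgroup.m_closed[OF H, of "path_class X (f \<circ> p)" "path_class X (f \<circ> q)"]
    by (simp add: ind mult_pi1 lp)
  then show "induced X f (a \<otimes>\<^bsub>pi1 T t\<^esub> b) \<in> H"
    using pq by (simp add: mult_pi1 ind loops_at_join joinpaths_o)
qed

lemma loops_at_ext:
  assumes "p \<in> loops_at X x" "\<And>t. t \<in> {0..1} \<Longrightarrow> p t = q t"
  shows "q \<in> loops_at X x"
proof -
  have "homotopic_paths X p q" using assms by (intro homotopic_paths_eq) (auto simp: loops_at_def)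
  then show ?thesis
    using assms(1) homotopic_paths_imp_path[of X p q] homotopic_paths_imp_subset[of X p q]
      homotopic_paths_imp_pathstart[of X p q] homotopic_paths_imp_pathfinish[of X p q]
    by (simp add: loops_at_def)
qed

section \<open>Loops conjugated by a path\<close>

definition paths_in :: "'a::topological_space set \<Rightarrow> 'a \<Rightarrow> 'a \<Rightarrow> (real \<Rightarrow> 'a) set" where
  "paths_in X a b = {p. path p \<and> path_image p \<subseteq> X \<and> pathstart p = a \<and> pathfinish p = b}"

lemma loops_at_eq_paths_in: "loops_at X x = paths_in X x x"
  by (simp add: loops_at_def paths_in_def)

lemma paths_in_join [intro]: "p \<in> paths_in X a b \<Longrightarrow> q \<in> paths_in X b c \<Longrightarrow> p +++ q \<in> paths_in X a c"
  by (auto simp: paths_in_def path_image_join)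

lemma paths_in_reversepath [intro]: "p \<in> paths_in X a b \<Longrightarrow> reversepath p \<in> paths_in X b a"
  by (auto simp: paths_in_def)

lemma paths_in_assoc:
  "p \<in> paths_in X a b \<Longrightarrow> q \<in> paths_in X b c \<Longrightarrow> r \<in> paths_in X c d \<Longrightarrow>
   homotopic_paths X (p +++ (q +++ r)) ((p +++ q) +++ r)"
  by (rule homotopic_paths_assoc) (auto simp: paths_in_def)

lemma paths_in_assoc':
  "p \<in> paths_in X a b \<Longrightarrow> q \<in> paths_in X b c \<Longrightarrow> r \<in> paths_in X c d \<Longrightarrow>
   homotopic_paths X ((p +++ q) +++ r) (p +++ (q +++ r))"
  by (rule homotopic_paths_sym, rule paths_in_assoc)

lemma paths_in_join_cong_right:
  "p \<in> paths_in X a b \<Longrightarrow> q \<in> paths_in X b c \<Longrightarrow> homotopic_paths X q q' \<Longrightarrow>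
   homotopic_paths X (p +++ q) (p +++ q')"
  by (rule homotopic_paths_join) (auto simp: paths_in_def)

lemma paths_in_join_cong_left:
  "p \<in> paths_in X a b \<Longrightarrow> q \<in> paths_in X b c \<Longrightarrow> homotopic_paths X p p' \<Longrightarrow>
   homotopic_paths X (p +++ q) (p' +++ q)"
  by (rule homotopic_paths_join) (auto simp: paths_in_def)

text \<open>For a loop at the end point of \<open>\<sigma>\<close>, this is the image of its class under the
  change-of-base-point isomorphism along \<open>\<sigma>\<close>.\<close>

definition conj_class :: "'a::topological_space set \<Rightarrow> (real \<Rightarrow> 'a) \<Rightarrow> (real \<Rightarrow> 'a) \<Rightarrow> (real \<Rightarrow> 'a) set" where
  "conj_class X \<sigma> p = path_class X (\<sigma> +++ p +++ reversepath \<sigma>)"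

context
  fixes X :: "'a::topological_space set" and x y :: 'a and \<sigma> :: "real \<Rightarrow> 'a"
  assumes \<sigma>: "\<sigma> \<in> paths_in X x y"
begin

lemma conj_loop: "p \<in> loops_at X y \<Longrightarrow> \<sigma> +++ p +++ reversepath \<sigma> \<in> loops_at X x"
  unfolding loops_at_eq_paths_in by (intro paths_in_join[OF \<sigma>] paths_in_join[OF _ paths_in_reversepath[OF \<sigma>]])

lemma conj_class_cong: 
  assumes "homotopic_paths X p q" "p \<in> loops_at X y" 
  shows "conj_class X \<sigma> p = conj_class X \<sigma> q"
proof -
  note p = assms(2)[unfolded loops_at_eq_paths_in]
  note \<sigma>' = paths_in_reversepath[OF \<sigma>]
  show ?thesis
    unfolding conj_class_def
    by (rule path_class_eqI[OF paths_in_join_cong_right[OF \<sigma> paths_in_join[OF p \<sigma>'] paths_in_join_cong_left[OF p \<sigma>' assms(1)]]])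
qed

lemma conj_class_join:
  assumes p: "p \<in> loops_at X y" and q: "q \<in> loops_at X y"
  shows "conj_class X \<sigma> (p +++ q) = conj_class X \<sigma> p \<otimes>\<^bsub>pi1 X x\<^esub> conj_class X \<sigma> q"
proof -
  note p' = p[unfolded loops_at_eq_paths_in] and q' = q[unfolded loops_at_eq_paths_in]
  define r where "r = q +++ reversepath \<sigma>"
  have r: "r \<in> paths_in X y x" unfolding r_def using \<sigma> q' by blast
  have \<sigma>': "reversepath \<sigma> \<in> paths_in X y x" using \<sigma> by blast
  have "homotopic_paths X (reversepath \<sigma> +++ \<sigma> +++ r) ((reversepath \<sigma> +++ \<sigma>) +++ r)"
    by (rule paths_in_assoc[OF \<sigma>' \<sigma> r])
  also have "homotopic_paths X \<dots> ((\<lambda>t. y) +++ r)"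
    using homotopic_paths_reversepath_join[of \<sigma> X] \<sigma>
    by (intro paths_in_join_cong_left[OF paths_in_join[OF \<sigma>' \<sigma>] r]) (auto simp: paths_in_def)
  also have "homotopic_paths X \<dots> r"
    by (rule homotopic_paths_const_join) (use r in \<open>auto simp: paths_in_def\<close>)
  finally have cancel: "homotopic_paths X (reversepath \<sigma> +++ \<sigma> +++ r) r" .
  have "homotopic_paths X ((\<sigma> +++ p +++ reversepath \<sigma>) +++ (\<sigma> +++ r)) (\<sigma> +++ ((p +++ reversepath \<sigma>) +++ (\<sigma> +++ r)))"
    by (rule paths_in_assoc'[OF \<sigma> paths_in_join[OF p' \<sigma>'] paths_in_join[OF \<sigma> r]])
  also have "homotopic_paths X \<dots> (\<sigma> +++ (p +++ (reversepath \<sigma> +++ (\<sigma> +++ r))))"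
    by (rule paths_in_join_cong_right[OF \<sigma> _ paths_in_assoc'[OF p' \<sigma>' paths_in_join[OF \<sigma> r]]])
      (use \<sigma> \<sigma>' r p' in blast)
  also have "homotopic_paths X \<dots> (\<sigma> +++ (p +++ r))"
    by (rule paths_in_join_cong_right[OF \<sigma> _ paths_in_join_cong_right[OF p' _ cancel]])
      (use \<sigma> \<sigma>' r p' in blast)+
  also have "homotopic_paths X \<dots> (\<sigma> +++ ((p +++ q) +++ reversepath \<sigma>))"
    unfolding r_def
    by (rule paths_in_join_cong_right[OF \<sigma> _ paths_in_assoc[OF p' q' \<sigma>']]) (use p' q' \<sigma>' in blast)
  finally show ?thesis
    by (simp add: conj_class_def mult_pi1 conj_loop p q r_def path_class_eqI[OF homotopic_paths_sym])
qed

lemma reversepath_conj_loop: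
  assumes p: "p \<in> loops_at X y"
  shows "homotopic_paths X (\<sigma> +++ reversepath p +++ reversepath \<sigma>) (reversepath (\<sigma> +++ p +++ reversepath \<sigma>))"
proof -
  have "reversepath (\<sigma> +++ p +++ reversepath \<sigma>) = (\<sigma> +++ reversepath p) +++ reversepath \<sigma>"
    using \<sigma> p by (simp add: reversepath_joinpaths loops_at_def paths_in_def)
  moreover have "homotopic_paths X (\<sigma> +++ reversepath p +++ reversepath \<sigma>) ((\<sigma> +++ reversepath p) +++ reversepath \<sigma>)"
    using p unfolding loops_at_eq_paths_in by (rule paths_in_assoc[OF \<sigma> paths_in_reversepath paths_in_reversepath[OF \<sigma>]])
  ultimately show ?thesis by simp
qed

lemma conj_class_reversepath:
  assumes p: "p \<in> loops_at X y"
  shows "conj_class X \<sigma> (reversepath p) = inv\<^bsub>pi1 X x\<^esub> (conj_class X \<sigma> p)"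
  unfolding conj_class_def inv_pi1[OF conj_loop[OF p]]
  by (rule path_class_eqI[OF reversepath_conj_loop[OF p]])

lemma conj_class_in_carrier: "p \<in> loops_at X y \<Longrightarrow> conj_class X \<sigma> p \<in> carrier (pi1 X x)"
  by (simp add: conj_class_def path_class_in_carrier conj_loop)

lemma conj_class_const: "conj_class X \<sigma> (\<lambda>t. y) = \<one>\<^bsub>pi1 X x\<^esub>"
proof -
  have \<sigma>': "reversepath \<sigma> \<in> paths_in X y x" using \<sigma> by blast
  have "homotopic_paths X (\<sigma> +++ (\<lambda>t. y) +++ reversepath \<sigma>) (\<sigma> +++ reversepath \<sigma>)"
  proof (rule paths_in_join_cong_right[OF \<sigma>, where c = x])
    show "(\<lambda>t. y) +++ reversepath \<sigma> \<in> paths_in X y x"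
      using \<sigma>' by (intro paths_in_join[OF _ \<sigma>']) (auto simp: paths_in_def)
    show "homotopic_paths X ((\<lambda>t. y) +++ reversepath \<sigma>) (reversepath \<sigma>)"
      using \<sigma>' by (intro homotopic_paths_const_join) (auto simp: paths_in_def)
  qed
  also have "homotopic_paths X \<dots> (\<lambda>t. x)"
    using homotopic_paths_join_reversepath[of \<sigma> X] \<sigma> by (simp add: paths_in_def)
  finally show ?thesis by (simp add: conj_class_def one_pi1 path_class_eqI)
qed

text \<open>Prolonging the connecting path by a loop at its start is a conjugation, the same for all loops \<open>p\<close>.
  This is what makes test-closedness invariant under conjugation.\<close>

lemma conj_class_prepend_loop:
  assumes \<alpha>: "\<alpha> \<in> loops_at X x" and p: "p \<in> loops_at X y"
  shows "conj_class X (\<alpha> +++ \<sigma>) p =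
         path_class X \<alpha> \<otimes>\<^bsub>pi1 X x\<^esub> conj_class X \<sigma> p \<otimes>\<^bsub>pi1 X x\<^esub> inv\<^bsub>pi1 X x\<^esub> path_class X \<alpha>"
proof -
  note a = \<alpha>[unfolded loops_at_eq_paths_in] and p' = p[unfolded loops_at_eq_paths_in]
  have \<sigma>': "reversepath \<sigma> \<in> paths_in X y x" using \<sigma> by blast
  have a': "reversepath \<alpha> \<in> paths_in X x x" using a by blast
  have ps: "p +++ reversepath \<sigma> \<in> paths_in X y x" and as: "\<alpha> +++ \<sigma> \<in> paths_in X x y" using a \<sigma> p' \<sigma>' by blast+
  let ?l = "\<sigma> +++ p +++ reversepath \<sigma>"
  have l: "?l \<in> paths_in X x x" using \<sigma> ps by blast
  have rev: "reversepath (\<alpha> +++ \<sigma>) = reversepath \<sigma> +++ reversepath \<alpha>"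
    using \<sigma> a by (simp add: reversepath_joinpaths paths_in_def)
  have "homotopic_paths X ((\<alpha> +++ \<sigma>) +++ (p +++ (reversepath \<sigma> +++ reversepath \<alpha>)))
          ((\<alpha> +++ \<sigma>) +++ ((p +++ reversepath \<sigma>) +++ reversepath \<alpha>))"
    by (rule paths_in_join_cong_right[OF as _ paths_in_assoc[OF p' \<sigma>' a']]) (use p' \<sigma>' a' in blast)
  also have "homotopic_paths X \<dots> (\<alpha> +++ (\<sigma> +++ ((p +++ reversepath \<sigma>) +++ reversepath \<alpha>)))"
    by (rule paths_in_assoc'[OF a \<sigma> paths_in_join[OF ps a']])
  also have "homotopic_paths X \<dots> (\<alpha> +++ (?l +++ reversepath \<alpha>))"
    by (rule paths_in_join_cong_right[OF a _ paths_in_assoc[OF \<sigma> ps a']]) (use \<sigma> ps a' in blast)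
  also have "homotopic_paths X \<dots> ((\<alpha> +++ ?l) +++ reversepath \<alpha>)"
    by (rule paths_in_assoc[OF a l a'])
  finally have "conj_class X (\<alpha> +++ \<sigma>) p = path_class X ((\<alpha> +++ ?l) +++ reversepath \<alpha>)"
    unfolding conj_class_def rev by (rule path_class_eqI)
  then show ?thesis
    by (simp add: conj_class_def inv_pi1 mult_pi1 conj_loop p \<alpha> loops_at_join loops_at_reversepath)
qed

end

section \<open>Concatenations over a family of disjoint gaps\<close>

text \<open>A pasting lemma for infinitely many closed pieces whose images shrink to a point \<open>y\<close>. Near a point
  where the value is \<open>y\<close>, all but finitely many pieces are mapped into a given neighbourhood of \<open>y\<close>; near any other
  point only finitely many pieces are present at all. Either way the finite pasting lemma applies.\<close>

lemma continuous_on_null_paste: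
  fixes g :: "'a::topological_space \<Rightarrow> 'b::topological_space"
  assumes cover: "S \<subseteq> Z \<union> (\<Union>i. K i)"
    and closed: "\<And>i. closed (K i)"
    and cont: "\<And>i. continuous_on (S \<inter> K i) g"
    and Z: "\<And>z. z \<in> Z \<Longrightarrow> g z = y"
    and null: "\<And>U. open U \<Longrightarrow> y \<in> U \<Longrightarrow> finite {i. \<not> g ` (S \<inter> K i) \<subseteq> U}"
    and locfin: "\<And>x. x \<in> S \<Longrightarrow> g x \<noteq> y \<Longrightarrow>
      \<exists>W. open W \<and> x \<in> W \<and> W \<inter> S \<inter> Z = {} \<and> finite {i. W \<inter> S \<inter> K i \<noteq> {}}"
  shows "continuous_on S g"
  unfolding continuous_on_topological
proof (intro ballI allI impI)
  fix x B assume x: "x \<in> S" and B: "open B" "g x \<in> B"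
  have "\<exists>W I. open W \<and> x \<in> W \<and> finite I \<and> (\<forall>z\<in>S \<inter> W. g z \<in> B \<or> (\<exists>i\<in>I. z \<in> K i))"
  proof (cases "g x = y")
    case True
    then have "finite {i. \<not> g ` (S \<inter> K i) \<subseteq> B}" using B null by blast
    moreover have "\<forall>z\<in>S \<inter> UNIV. g z \<in> B \<or> (\<exists>i\<in>{i. \<not> g ` (S \<inter> K i) \<subseteq> B}. z \<in> K i)"
      using cover Z True B by fastforce
    ultimately show ?thesis using open_UNIV by blast
  next
    case False
    then obtain W where "open W" "x \<in> W" "W \<inter> S \<inter> Z = {}" "finite {i. W \<inter> S \<inter> K i \<noteq> {}}"
      using locfin x by blast
    moreover from this have "\<forall>z\<in>S \<inter> W. g z \<in> B \<or> (\<exists>i\<in>{i. W \<inter> S \<inter> K i \<noteq> {}}. z \<in> K i)"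
      using cover by blast
    ultimately show ?thesis by blast
  qed
  then obtain W I where W: "open W" "x \<in> W" "finite I"
    and WI: "\<And>z. z \<in> S \<Longrightarrow> z \<in> W \<Longrightarrow> g z \<in> B \<or> (\<exists>i\<in>I. z \<in> K i)"
    by auto
  have "\<exists>A. open A \<and> x \<in> A \<and> (\<forall>z\<in>S \<inter> K i. z \<in> A \<longrightarrow> g z \<in> B)" for i
  proof (cases "x \<in> K i")
    case True
    then show ?thesis using cont[of i, unfolded continuous_on_topological] x B by blast
  next
    case False
    then show ?thesis using closed[of i] by (intro exI[of _ "- K i"]) auto
  qed
  then obtain A where A: "\<And>i. open (A i)" "\<And>i. x \<in> A i" "\<And>i z. z \<in> S \<inter> K i \<Longrightarrow> z \<in> A i \<Longrightarrow> g z \<in> B"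
    by metis
  show "\<exists>A. open A \<and> x \<in> A \<and> (\<forall>z\<in>S. z \<in> A \<longrightarrow> g z \<in> B)"
    using W WI A by (intro exI[of _ "W \<inter> (\<Inter>i\<in>I. A i)"]) (auto intro!: open_Int open_INT, blast)
qed

text \<open>Both \<open>ell_inf\<close> and \<open>ell_tau\<close> are concatenations of loops over countably many disjoint
  subintervals of the unit interval, in the order type of these intervals. Indices start at 1, as
  those of the circles do.\<close>

locale gap_family =
  fixes a b :: "nat \<Rightarrow> real"
  assumes a_nonneg: "1 \<le> n \<Longrightarrow> 0 \<le> a n"
    and a_less_b: "1 \<le> n \<Longrightarrow> a n < b n"
    and b_le_1: "1 \<le> n \<Longrightarrow> b n \<le> 1"
    and disjoint: "1 \<le> m \<Longrightarrow> 1 \<le> n \<Longrightarrow> a m < t \<Longrightarrow> t < b m \<Longrightarrow> a n < t \<Longrightarrow> t < b n \<Longrightarrow> m = n"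
begin

definition concat_over :: "(nat \<Rightarrow> real \<Rightarrow> 'b) \<Rightarrow> 'b \<Rightarrow> real \<Rightarrow> 'b" where
  "concat_over \<gamma> y t =
     (if \<exists>n\<ge>1. a n < t \<and> t < b n
      then let n = THE n. 1 \<le> n \<and> a n < t \<and> t < b n in \<gamma> n ((t - a n) / (b n - a n))
      else y)"

lemma endpoint_not_in_gap:
  assumes "1 \<le> m" "1 \<le> n" "t = a m \<or> t = b m"
  shows "\<not> (a n < t \<and> t < b n)"
proof
  assume t: "a n < t \<and> t < b n"
  \<comment> \<open>If an end point of one gap were inside another gap, the two would overlap at this point.\<close>
  define l where "l = (if t = a m then (t + min (b m) (b n)) / 2 else (t + max (a m) (a n)) / 2)"
  have "m = n"
    using a_less_b[of m] a_less_b[of n] assms t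
    by (intro disjoint[of m n l]) (auto simp: l_def min_def max_def split: if_splits)
  then show False using t assms by auto
qed

lemma concat_over_open:
  assumes "1 \<le> n" "a n < t" "t < b n"
  shows "concat_over \<gamma> y t = \<gamma> n ((t - a n) / (b n - a n))"
proof -
  have "(THE n. 1 \<le> n \<and> a n < t \<and> t < b n) = n"
    using assms disjoint by (intro the_equality) blast+
  then show ?thesis using assms unfolding concat_over_def Let_def by auto
qed

lemma concat_over_outside: "(\<And>n. 1 \<le> n \<Longrightarrow> \<not> (a n < t \<and> t < b n)) \<Longrightarrow> concat_over \<gamma> y t = y"
  unfolding concat_over_def by auto

lemma concat_over_closed:
  assumes "1 \<le> n" "a n \<le> t" "t \<le> b n" "\<gamma> n 0 = y" "\<gamma> n 1 = y"
  shows "concat_over \<gamma> y t = \<gamma> n ((t - a n) / (b n - a n))"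
proof (cases "t = a n \<or> t = b n")
  case True
  then have "concat_over \<gamma> y t = y"
    using endpoint_not_in_gap[OF assms(1) _ True] by (intro concat_over_outside) blast
  then show ?thesis using True assms a_less_b[of n] by auto
next
  case False
  then show ?thesis using assms by (intro concat_over_open) auto
qed

text \<open>Concatenation is continuous in families: the parameter \<open>s\<close> provides both homotopies between
  concatenations (with \<open>S\<close> the unit interval) and continuity of a single one (with \<open>S\<close> a point).\<close>

lemma continuous_on_concat_over_family:
  fixes h :: "nat \<Rightarrow> 'p::topological_space \<Rightarrow> real \<Rightarrow> 'b::topological_space"
  assumes cont: "\<And>n. 1 \<le> n \<Longrightarrow> continuous_on (S \<times> {0..1}) (\<lambda>z. h n (fst z) (snd z))"
    and ends: "\<And>n s. 1 \<le> n \<Longrightarrow> s \<in> S \<Longrightarrow> h n s 0 = y" "\<And>n s. 1 \<le> n \<Longrightarrow> s \<in> S \<Longrightarrow> h n s 1 = y"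
    and null: "\<And>U. open U \<Longrightarrow> y \<in> U \<Longrightarrow> finite {n. 1 \<le> n \<and> \<not> (\<forall>s\<in>S. h n s ` {0..1} \<subseteq> U)}"
  shows "continuous_on (S \<times> {0..1}) (\<lambda>z. concat_over (\<lambda>n. h n (fst z)) y (snd z))"
proof (rule continuous_on_null_paste[where K = "\<lambda>n. UNIV \<times> {a (Suc n)..b (Suc n)}" and y = y
      and Z = "{z. \<forall>n\<ge>1. \<not> (a n < snd z \<and> snd z < b n)}"])
  let ?g = "\<lambda>z. concat_over (\<lambda>n. h n (fst z)) y (snd z)"
  have in01: "(t - a n) / (b n - a n) \<in> {0..1}" if "1 \<le> n" "a n \<le> t" "t \<le> b n" for n t
    using that a_less_b[of n] by (auto simp: field_simps)
  have on_gap: "?g (s, t) = h (Suc n) s ((t - a (Suc n)) / (b (Suc n) - a (Suc n)))"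
    if "s \<in> S" "a (Suc n) \<le> t" "t \<le> b (Suc n)" for s t n
    using that ends by (simp add: concat_over_closed[of "Suc n"])
  show "S \<times> {0..1} \<subseteq> {z. \<forall>n\<ge>1. \<not> (a n < snd z \<and> snd z < b n)} \<union> (\<Union>n. UNIV \<times> {a (Suc n)..b (Suc n)})"
  proof
    fix z :: "'p \<times> real"
    show "z \<in> {z. \<forall>n\<ge>1. \<not> (a n < snd z \<and> snd z < b n)} \<union> (\<Union>n. UNIV \<times> {a (Suc n)..b (Suc n)})"
    proof (cases "\<exists>n\<ge>1. a n < snd z \<and> snd z < b n")
      case True
      then obtain n where "a (Suc n) < snd z \<and> snd z < b (Suc n)"
        by (metis Suc_le_D One_nat_def)
      then show ?thesis by (intro UnI2 UN_I[of n]) (auto simp: mem_Times_iff)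
    qed auto
  qed
  show "closed (UNIV \<times> {a (Suc n)..b (Suc n)} :: ('p \<times> real) set)" for n
    by (intro closed_Times) auto
  show "continuous_on (S \<times> {0..1} \<inter> UNIV \<times> {a (Suc n)..b (Suc n)}) ?g" for n
  proof -
    let ?q = "\<lambda>z. (fst z, (snd z - a (Suc n)) / (b (Suc n) - a (Suc n)))"
    have "continuous_on (S \<times> {a (Suc n)..b (Suc n)}) (\<lambda>z. h (Suc n) (fst (?q z)) (snd (?q z)))"
    proof (rule continuous_on_compose2[OF cont])
      show "continuous_on (S \<times> {a (Suc n)..b (Suc n)}) ?q"
        using a_less_b[of "Suc n"] by (intro continuous_intros) auto
      show "?q ` (S \<times> {a (Suc n)..b (Suc n)}) \<subseteq> S \<times> {0..1}"
        using in01[of "Suc n"] by auto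
    qed simp
    then have "continuous_on (S \<times> {a (Suc n)..b (Suc n)}) ?g"
      by (rule continuous_on_eq) (use on_gap in auto)
    then show ?thesis by (rule continuous_on_subset) auto
  qed
  show "finite {n. \<not> ?g ` (S \<times> {0..1} \<inter> UNIV \<times> {a (Suc n)..b (Suc n)}) \<subseteq> U}" if U: "open U" "y \<in> U" for U
  proof (rule finite_subset)
    show "finite (Suc -` {n. 1 \<le> n \<and> \<not> (\<forall>s\<in>S. h n s ` {0..1} \<subseteq> U)})"
      by (intro finite_vimageI null U) auto
    have "?g ` (S \<times> {0..1} \<inter> UNIV \<times> {a (Suc n)..b (Suc n)}) \<subseteq> U"
      if sub: "\<forall>s\<in>S. h (Suc n) s ` {0..1} \<subseteq> U" for n
    proof (rule image_subsetI)
      fix z assume z: "z \<in> S \<times> {0..1} \<inter> UNIV \<times> {a (Suc n)..b (Suc n)}"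
      define w where "w = (snd z - a (Suc n)) / (b (Suc n) - a (Suc n))"
      have "w \<in> {0..1}" unfolding w_def using z by (intro in01) auto
      moreover have "?g z = h (Suc n) (fst z) w"
        using z on_gap[of "fst z" n "snd z"] by (auto simp: w_def)
      ultimately show "?g z \<in> U" using sub z by (auto simp: image_subset_iff)
    qed
    note sub_imp = this
    show "{n. \<not> ?g ` (S \<times> {0..1} \<inter> UNIV \<times> {a (Suc n)..b (Suc n)}) \<subseteq> U} \<subseteq>
        Suc -` {n. 1 \<le> n \<and> \<not> (\<forall>s\<in>S. h n s ` {0..1} \<subseteq> U)}"
    proof
      fix n assume "n \<in> {n. \<not> ?g ` (S \<times> {0..1} \<inter> UNIV \<times> {a (Suc n)..b (Suc n)}) \<subseteq> U}"
      then have "\<not> (\<forall>s\<in>S. h (Suc n) s ` {0..1} \<subseteq> U)" using sub_imp[of n] by blast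
      then show "n \<in> Suc -` {n. 1 \<le> n \<and> \<not> (\<forall>s\<in>S. h n s ` {0..1} \<subseteq> U)}" by simp
    qed
  qed
  show "\<exists>W. open W \<and> z \<in> W \<and> W \<inter> (S \<times> {0..1}) \<inter> {z. \<forall>n\<ge>1. \<not> (a n < snd z \<and> snd z < b n)} = {} \<and>
      finite {n. W \<inter> (S \<times> {0..1}) \<inter> UNIV \<times> {a (Suc n)..b (Suc n)} \<noteq> {}}"
    if z: "z \<in> S \<times> {0..1}" "?g z \<noteq> y" for z
  proof -
    obtain m where m: "1 \<le> m" "a m < snd z" "snd z < b m"
      using z(2) concat_over_outside[of "snd z" "\<lambda>n. h n (fst z)" y] by blast
    let ?W = "UNIV \<times> {a m<..<b m} :: ('p \<times> real) set"
    have "n = m - 1" if "?W \<inter> (S \<times> {0..1}) \<inter> UNIV \<times> {a (Suc n)..b (Suc n)} \<noteq> {}" for n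
    proof -
      from that obtain s where s: "a m < s" "s < b m" "a (Suc n) \<le> s" "s \<le> b (Suc n)" by auto
      then have "a (Suc n) < s \<and> s < b (Suc n)"
        using endpoint_not_in_gap[of "Suc n" m s] m by force
      then have "m = Suc n" using s m by (intro disjoint[of m "Suc n" s]) auto
      then show ?thesis by simp
    qed
    then have "{n. ?W \<inter> (S \<times> {0..1}) \<inter> UNIV \<times> {a (Suc n)..b (Suc n)} \<noteq> {}} \<subseteq> {m - 1}" by blast
    then have "finite {n. ?W \<inter> (S \<times> {0..1}) \<inter> UNIV \<times> {a (Suc n)..b (Suc n)} \<noteq> {}}"
      by (rule finite_subset) simp
    moreover have "open ?W" by (intro open_Times) auto
    moreover have "?W \<inter> (S \<times> {0..1}) \<inter> {z. \<forall>n\<ge>1. \<not> (a n < snd z \<and> snd z < b n)} = {}"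
      using m(1) by auto
    ultimately show ?thesis using m by (intro exI[of _ ?W]) (auto simp: mem_Times_iff)
  qed
qed (auto simp: concat_over_outside)

lemma continuous_on_concat_over:
  fixes \<gamma> :: "nat \<Rightarrow> real \<Rightarrow> 'b::topological_space"
  assumes path: "\<And>n. 1 \<le> n \<Longrightarrow> path (\<gamma> n)"
    and ends: "\<And>n. 1 \<le> n \<Longrightarrow> \<gamma> n 0 = y" "\<And>n. 1 \<le> n \<Longrightarrow> \<gamma> n 1 = y"
    and null: "\<And>U. open U \<Longrightarrow> y \<in> U \<Longrightarrow> finite {n. 1 \<le> n \<and> \<not> path_image (\<gamma> n) \<subseteq> U}"
  shows "continuous_on {0..1} (concat_over \<gamma> y)"
proof -
  have "continuous_on ({0::real} \<times> {0..1}) (\<lambda>z. concat_over (\<lambda>n. (\<lambda>s. \<gamma> n) (fst z)) y (snd z))"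
  proof (rule continuous_on_concat_over_family)
    show "continuous_on ({0::real} \<times> {0..1}) (\<lambda>z. \<gamma> n (snd z))" if "1 \<le> n" for n
      by (rule continuous_on_compose2[of "{0..1}" "\<gamma> n"])
        (use path[OF that] in \<open>auto simp: path_def intro: continuous_intros\<close>)
    show "finite {n. 1 \<le> n \<and> \<not> (\<forall>s\<in>{0::real}. \<gamma> n ` {0..1} \<subseteq> U)}" if "open U" "y \<in> U" for U
      by (rule finite_subset[OF _ null[OF that]]) (auto simp: path_image_def)
  qed (use ends in auto)
  then have "continuous_on {0..1} (\<lambda>t. concat_over \<gamma> y (snd (0::real, t)))"
    by (rule continuous_on_compose2) (auto intro: continuous_intros)
  then show ?thesis by simp
qed

lemma concat_over_ends: "concat_over \<gamma> y 0 = y" "concat_over \<gamma> y 1 = y"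
  using a_nonneg b_le_1 by (intro concat_over_outside; fastforce)+

lemma concat_over_in:
  assumes "y \<in> T" "\<And>n. 1 \<le> n \<Longrightarrow> \<gamma> n ` {0..1} \<subseteq> T"
  shows "concat_over \<gamma> y t \<in> T"
proof (cases "\<exists>n\<ge>1. a n < t \<and> t < b n")
  case True
  then obtain n where n: "1 \<le> n" "a n < t" "t < b n" by blast
  then have "(t - a n) / (b n - a n) \<in> {0..1}" by (auto simp: field_simps)
  then show ?thesis unfolding concat_over_open[OF n] using assms(2)[OF n(1)] by blast
next
  case False
  then show ?thesis using assms(1) by (simp add: concat_over_outside)
qed

lemma concat_over_loop:
  fixes \<gamma> :: "nat \<Rightarrow> real \<Rightarrow> 'b::topological_space"
  assumes loops: "\<And>n. 1 \<le> n \<Longrightarrow> \<gamma> n \<in> loops_at T y" and y: "y \<in> T"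
    and null: "\<And>U. open U \<Longrightarrow> y \<in> U \<Longrightarrow> finite {n. 1 \<le> n \<and> \<not> path_image (\<gamma> n) \<subseteq> U}"
  shows "concat_over \<gamma> y \<in> loops_at T y"
proof -
  have "path (concat_over \<gamma> y)"
    unfolding path_def
    by (rule continuous_on_concat_over)
      (use loops null in \<open>auto simp: loops_at_def pathstart_def pathfinish_def\<close>)
  moreover have "concat_over \<gamma> y t \<in> T" for t
    by (rule concat_over_in[OF y]) (use loops in \<open>auto simp: loops_at_def path_image_def\<close>)
  ultimately show ?thesis
    by (auto simp: loops_at_def pathstart_def pathfinish_def path_image_def concat_over_ends)
qed

text \<open>This allows infinitely many null-homotopies to be performed at once.\<close>

lemma homotopic_paths_concat_over:
  fixes h :: "nat \<Rightarrow> real \<Rightarrow> real \<Rightarrow> 'b::topological_space"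
  assumes cont: "\<And>n. 1 \<le> n \<Longrightarrow> continuous_on ({0..1} \<times> {0..1}) (\<lambda>z. h n (fst z) (snd z))"
    and ends: "\<And>n s. 1 \<le> n \<Longrightarrow> s \<in> {0..1} \<Longrightarrow> h n s 0 = y" "\<And>n s. 1 \<le> n \<Longrightarrow> s \<in> {0..1} \<Longrightarrow> h n s 1 = y"
    and null: "\<And>U. open U \<Longrightarrow> y \<in> U \<Longrightarrow> finite {n. 1 \<le> n \<and> \<not> (\<forall>s\<in>{0..1}. h n s ` {0..1} \<subseteq> U)}"
    and T: "y \<in> T" "\<And>n s. 1 \<le> n \<Longrightarrow> s \<in> {0..1} \<Longrightarrow> h n s ` {0..1} \<subseteq> T"
  shows "homotopic_paths T (concat_over (\<lambda>n. h n 0) y) (concat_over (\<lambda>n. h n 1) y)"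
  unfolding homotopic_paths
proof (intro exI conjI)
  let ?H = "\<lambda>z. concat_over (\<lambda>n. h n (fst z)) y (snd z)"
  show "continuous_on ({0..1} \<times> {0..1}) ?H"
    by (rule continuous_on_concat_over_family) (use assms in auto)
  show "?H \<in> {0..1} \<times> {0..1} \<rightarrow> T"
  proof (rule Pi_I)
    fix z :: "real \<times> real" assume "z \<in> {0..1} \<times> {0..1}"
    then have "fst z \<in> {0..1}" by auto
    then show "?H z \<in> T" by (intro concat_over_in T)
  qed
qed (auto simp: pathstart_def pathfinish_def concat_over_ends)

lemma compose_concat_over:
  assumes "\<And>n t. 1 \<le> n \<Longrightarrow> t \<in> {0..1} \<Longrightarrow> F (\<delta> n t) = \<gamma> n t" "F x = y"
  shows "F (concat_over \<delta> x t) = concat_over \<gamma> y t"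
proof (cases "\<exists>n\<ge>1. a n < t \<and> t < b n")
  case True
  then obtain n where n: "1 \<le> n" "a n < t" "t < b n" by blast
  then show ?thesis using assms by (simp add: concat_over_open[OF n])
next
  case False
  then show ?thesis using assms by (simp add: concat_over_outside)
qed

end

section \<open>The Hawaiian earring\<close>

lemma ell_ends [simp]: "ell n 0 = b0" "ell n 1 = b0"
  by (auto simp: ell_def b0_def cos_add sin_add)

lemma path_ell: "path (ell n)"
  unfolding path_def ell_def divide_inverse by (intro continuous_intros)

lemma mem_hcircle:
  assumes "1 \<le> n"
  shows "(x, y) \<in> hcircle n \<longleftrightarrow> x\<^sup>2 + y\<^sup>2 = 2 * x / real n"
proof -
  have "(x, y) \<in> hcircle n \<longleftrightarrow> sqrt ((1 / real n - x)\<^sup>2 + y\<^sup>2) = 1 / real n"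
    by (simp add: hcircle_def dist_Pair_Pair dist_real_def)
  also have "\<dots> \<longleftrightarrow> (1 / real n - x)\<^sup>2 + y\<^sup>2 = (1 / real n)\<^sup>2"
    using assms by (metis of_nat_0_le_iff real_sqrt_abs real_sqrt_eq_iff abs_of_nonneg zero_le_divide_1_iff)
  also have "\<dots> \<longleftrightarrow> x\<^sup>2 + y\<^sup>2 = 2 * x / real n"
    by (simp add: power2_eq_square algebra_simps)
  finally show ?thesis .
qed

lemma ell_in_hcircle: 
  assumes "1 \<le> n" shows "ell n t \<in> hcircle n"
proof -
  define s c where "s = sin (pi + 2 * pi * t)" and "c = cos (pi + 2 * pi * t)"
  have "s\<^sup>2 + c\<^sup>2 = 1" by (simp add: s_def c_def)
  then have "(1 / real n + c / real n)\<^sup>2 + (s / real n)\<^sup>2 = 2 * (1 / real n + c / real n) / real n"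
    using assms by (simp add: power2_eq_square field_simps)
  then show ?thesis using mem_hcircle[OF assms] by (simp add: ell_def s_def c_def)
qed

lemma ell_in_earring: "1 \<le> n \<Longrightarrow> ell n t \<in> earring"
  using ell_in_hcircle by (auto simp: earring_def)

lemma ell_surj:
  assumes "1 \<le> n" "z \<in> hcircle n"
  shows "\<exists>t\<in>{0..1}. ell n t = z"
proof -
  obtain x y where z: "z = (x, y)" by fastforce
  have *: "x\<^sup>2 + y\<^sup>2 = 2 * x / real n" using assms z mem_hcircle by auto
  have "real n * (real n * (x\<^sup>2 + y\<^sup>2)) = 2 * x * real n"
    unfolding * using assms(1) by simp
  then have "(1 - real n * x)\<^sup>2 + (- real n * y)\<^sup>2 = 1"
    by (simp add: power2_eq_square algebra_simps)
  then obtain u where u: "0 \<le> u" "u < 2 * pi" "1 - real n * x = cos u" "- real n * y = sin u"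
    using sincos_total_2pi by blast
  have "x = 1 / real n - cos u / real n" "y = - sin u / real n"
    using u(3,4) assms(1) by (auto simp: field_simps)
  then have "ell n (u / (2 * pi)) = z"
    using z by (simp add: ell_def cos_add sin_add)
  moreover have "u / (2 * pi) \<in> {0..1}" using u by auto
  ultimately show ?thesis by blast
qed

lemma ell_eq_b0:
  assumes "1 \<le> n" "0 < t" "t < 1"
  shows "ell n t \<noteq> b0"
proof
  assume "ell n t = b0"
  then have "cos (2 * pi * t) = 1"
    using assms by (auto simp: ell_def b0_def cos_add divide_simps)
  then obtain k :: int where "2 * pi * t = of_int k * 2 * pi"
    using cos_one_2pi_int by blast
  then have "t = of_int k" by simp
  then show False using assms by simp
qed

text \<open>The circles meet only at the origin, and each is traversed injectively in the open unit interval.\<close>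

lemma ell_inject:
  assumes "1 \<le> m" "1 \<le> n" "0 < t" "t < 1" "0 < u" "u < 1" and eq: "ell m t = ell n u"
  shows "m = n \<and> t = u"
proof -
  obtain x y where z: "ell m t = (x, y)" by fastforce
  have *: "x\<^sup>2 + y\<^sup>2 = 2 * x / real m" "x\<^sup>2 + y\<^sup>2 = 2 * x / real n"
    using ell_in_hcircle[of m t] ell_in_hcircle[of n u] mem_hcircle[of m x y] mem_hcircle[of n x y] assms z
    by simp_all
  have "x \<noteq> 0"
  proof
    assume "x = 0"
    then have "y = 0" using * by simp
    then show False using ell_eq_b0[of m t] assms z \<open>x = 0\<close> by (simp add: b0_def)
  qed
  then have mn: "m = n" using * assms by (auto simp: field_simps)
  have "sin (2 * pi * t) = sin (2 * pi * u)" "cos (2 * pi * t) = cos (2 * pi * u)"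
    using eq mn assms(1) by (auto simp: ell_def cos_add sin_add divide_simps)
  then obtain k :: int where "2 * pi * t = 2 * pi * u + 2 * pi * k"
    using sin_cos_eq_iff by blast
  then have "2 * pi * t = 2 * pi * (u + k)" by (simp add: algebra_simps)
  then have "t = u + k" by simp
  moreover from this have "k = 0" using assms by linarith
  ultimately show ?thesis using mn by simp
qed

lemma norm_ell_le: "1 \<le> n \<Longrightarrow> norm (ell n t) \<le> 2 / real n"
proof -
  assume n: "1 \<le> n"
  have "norm (ell n t) = dist (ell n t) 0" by simp
  also have "\<dots> \<le> dist (ell n t) (1 / real n, 0) + dist (1 / real n, 0) (0 :: real \<times> real)"
    by (rule dist_triangle)
  also have "dist (ell n t) (1 / real n, 0) = 1 / real n"
    using ell_in_hcircle[OF n, of t] by (simp add: hcircle_def dist_commute)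
  also have "dist (1 / real n, 0) (0 :: real \<times> real) = 1 / real n"
    by (simp add: norm_Pair)
  finally show ?thesis by simp
qed

lemma ell_null:
  assumes "open U" "b0 \<in> U"
  shows "finite {n. 1 \<le> n \<and> \<not> path_image (ell n) \<subseteq> U}"
proof -
  obtain e where e: "e > 0" "ball b0 e \<subseteq> U" using assms open_contains_ball by blast
  obtain N where N: "2 / e < real N" using reals_Archimedean2 by blast
  have "path_image (ell n) \<subseteq> U" if "1 \<le> n" "N \<le> n" for n
  proof -
    have "2 / e < real n" using N that by linarith
    then have "2 / real n < e" using e that by (simp add: field_simps)
    then have "ell n t \<in> ball b0 e" for t
      using norm_ell_le[OF that(1), of t] by (simp add: b0_def dist_norm norm_minus_commute flip: zero_prod_def)
    then show ?thesis using e by (auto simp: path_image_def)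
  qed
  then have "{n. 1 \<le> n \<and> \<not> path_image (ell n) \<subseteq> U} \<subseteq> {..N}"
    using linear by blast
  then show ?thesis by (rule finite_subset) simp
qed

lemma earring_cases:
  assumes "z \<in> earring"
  obtains n t where "1 \<le> n" "t \<in> {0..1}" "z = ell n t"
proof -
  obtain n where n: "1 \<le> n" "z \<in> hcircle n"
    using assms by (auto simp: earring_def)
  obtain t where "t \<in> {0..1}" "ell n t = z"
    using ell_surj[OF n] by blast
  then show thesis using that[of n t] n by simp
qed

definition harm_a :: "nat \<Rightarrow> real" where "harm_a n = (real n - 1) / real n"
definition harm_b :: "nat \<Rightarrow> real" where "harm_b n = real n / (real n + 1)"

lemma harm_b_eq: "harm_b n = harm_a (Suc n)" by (simp add: harm_a_def harm_b_def add.commute)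

lemma harm_a_mono: "1 \<le> m \<Longrightarrow> m \<le> n \<Longrightarrow> harm_a m \<le> harm_a n"
  by (simp add: harm_a_def field_simps)

interpretation harm: gap_family harm_a harm_b
proof
  show "m = n" if "1 \<le> m" "1 \<le> n" "harm_a m < t" "t < harm_b m" "harm_a n < t" "t < harm_b n" for m n t
  proof (rule ccontr)
    assume "m \<noteq> n"
    then consider "Suc m \<le> n" | "Suc n \<le> m" by linarith
    then show False using harm_a_mono[of "Suc m" n] harm_a_mono[of "Suc n" m] that
      by cases (auto simp: harm_b_eq)
  qed
qed (auto simp: harm_a_def harm_b_def field_simps)

lemma harm_cover:
  assumes "0 \<le> t" "t < 1"
  obtains n where "1 \<le> n" "harm_a n \<le> t" "t < harm_b n"
proof
  define n where "n = nat \<lfloor>1 / (1 - t)\<rfloor>"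
  have 1: "1 \<le> 1 / (1 - t)" using assms by simp
  then have fl: "1 \<le> \<lfloor>1 / (1 - t)\<rfloor>" by linarith
  then show n: "1 \<le> n" unfolding n_def by linarith
  have rn: "real n = of_int \<lfloor>1 / (1 - t)\<rfloor>" using fl of_nat_nat[of "\<lfloor>1 / (1 - t)\<rfloor>"] unfolding n_def by linarith
  have "real n \<le> 1 / (1 - t)" "1 / (1 - t) < real n + 1" unfolding rn by linarith+
  then have "real n * (1 - t) \<le> 1" "1 < (real n + 1) * (1 - t)"
    using assms by (auto simp: field_simps)
  then show "harm_a n \<le> t" "t < harm_b n"
    using n by (auto simp: harm_a_def harm_b_def field_simps)
qed

lemma ell_inf_eq: "t \<in> {0..1} \<Longrightarrow> ell_inf t = harm.concat_over ell b0 t"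
proof -
  assume t: "t \<in> {0..1}"
  show ?thesis
  proof (cases "t = 1")
    case True
    then show ?thesis using harm.b_le_1 by (subst harm.concat_over_outside) (fastforce simp: ell_inf_def)+
  next
    case False
    then obtain n where n: "1 \<le> n" "harm_a n \<le> t" "t < harm_b n" using t harm_cover[of t] by auto
    have "(THE n. 1 \<le> n \<and> (real n - 1) / real n \<le> t \<and> t < real n / (real n + 1)) = n"
      unfolding harm_a_def[symmetric] harm_b_def[symmetric]
    proof (rule the_equality)
      fix m assume m: "1 \<le> m \<and> harm_a m \<le> t \<and> t < harm_b m"
      show "m = n"
      proof (rule ccontr)
        assume "m \<noteq> n"
        then consider "Suc m \<le> n" | "Suc n \<le> m" by linarith
        then show False using harm_a_mono[of "Suc m" n] harm_a_mono[of "Suc n" m] m n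
          by cases (auto simp: harm_b_eq)
      qed
    qed (use n in auto)
    then have "ell_inf t = ell n ((t - harm_a n) / (harm_b n - harm_a n))"
      using t False by (simp add: ell_inf_def harm_a_def harm_b_def Let_def)
    then show ?thesis using n by (simp add: harm.concat_over_closed[of n])
  qed
qed

lemma b0_in_earring: "b0 \<in> earring"
  using ell_in_earring[of 1 0] by simp

lemma ell_loop: "1 \<le> n \<Longrightarrow> ell n \<in> loops_at earring b0"
  using ell_in_earring by (auto simp: loops_at_def path_ell pathstart_def pathfinish_def path_image_def)

lemma ell_inf_loop: "ell_inf \<in> loops_at earring b0"
proof (rule loops_at_ext)
  show "harm.concat_over ell b0 \<in> loops_at earring b0"
    by (intro harm.concat_over_loop ell_loop b0_in_earring ell_null)
qed (simp add: ell_inf_eq)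

lemma path_ell_inf: "path ell_inf"
  using ell_inf_loop by (simp add: loops_at_def)

lemma ell_inf_surj: "ell_inf ` {0..1} = earring"
proof
  show "ell_inf ` {0..1} \<subseteq> earring"
    using ell_inf_loop by (auto simp: loops_at_def path_image_def)
  show "earring \<subseteq> ell_inf ` {0..1}"
  proof
    fix z assume "z \<in> earring"
    then obtain n u where nu: "1 \<le> n" "u \<in> {0..1}" "z = ell n u" by (rule earring_cases)
    define t where "t = harm_a n + u * (harm_b n - harm_a n)"
    have ab: "harm_a n < harm_b n" using harm.a_less_b nu by simp
    have "0 \<le> u * (harm_b n - harm_a n)" "u * (harm_b n - harm_a n) \<le> harm_b n - harm_a n"
      using nu ab by (auto intro: mult_left_le_one_le)
    then have t: "harm_a n \<le> t" "t \<le> harm_b n"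
      unfolding t_def by linarith+
    have "(t - harm_a n) / (harm_b n - harm_a n) = u" using ab by (simp add: t_def)
    then have "harm.concat_over ell b0 t = z"
      using t nu by (simp add: harm.concat_over_closed[of n])
    moreover have "t \<in> {0..1}" using t harm.a_nonneg[of n] harm.b_le_1[of n] nu by simp
    ultimately show "z \<in> ell_inf ` {0..1}" using ell_inf_eq by force
  qed
qed

lemma compact_earring: "compact earring"
  using compact_continuous_image[OF path_ell_inf[unfolded path_def]] ell_inf_surj by simp

text \<open>If a concatenation of the circles passes through a point of the earring, then any concatenation of loops
  \<open>\<gamma> n\<close> over the same gaps takes there the value that the circle determines. Thus
  the latter factors through the former.\<close>

lemma (in gap_family) ell_fibre:
  assumes "concat_over ell b0 t = ell n u" "1 \<le> n" "u \<in> {0..1}" and ends: "\<And>n. 1 \<le> n \<Longrightarrow> \<gamma> n 0 = y" "\<And>n. 1 \<le> n \<Longrightarrow> \<gamma> n 1 = y"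
  shows "concat_over \<gamma> y t = \<gamma> n u"
proof (cases "\<exists>m\<ge>1. a m < t \<and> t < b m")
  case True
  then obtain m where m: "1 \<le> m" "a m < t" "t < b m" by blast
  define s where "s = (t - a m) / (b m - a m)"
  have s: "0 < s" "s < 1" using m by (auto simp: s_def)
  have eq: "ell m s = ell n u" and g: "concat_over \<gamma> y t = \<gamma> m s"
    using assms(1) concat_over_open[OF m, of ell b0] concat_over_open[OF m, of \<gamma> y] by (simp_all add: s_def)
  have "0 < u \<and> u < 1"
    using eq assms(3) ell_eq_b0[OF m(1) s] by (cases "u = 0 \<or> u = 1") auto
  then show ?thesis using ell_inject[of m n s u] m s eq assms(2) g by auto
next
  case False
  then have *: "concat_over \<gamma> y t = y" "concat_over ell b0 t = b0" by (auto intro: concat_over_outside)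
  then have "u = 0 \<or> u = 1" using assms(1-3) ell_eq_b0[of n u] by force
  then show ?thesis using * ends assms(2) by auto
qed

text \<open>Since \<open>ell_inf\<close> maps the compact unit interval onto the earring, it is a quotient map. A function
  on the earring is therefore continuous once its composition with \<open>ell_inf\<close> is, and this composition
  is a concatenation over gaps.\<close>

lemma earring_map_exists:
  fixes \<gamma> :: "nat \<Rightarrow> real \<Rightarrow> 'b::topological_space"
  assumes path: "\<And>n. 1 \<le> n \<Longrightarrow> path (\<gamma> n)"
    and ends: "\<And>n. 1 \<le> n \<Longrightarrow> \<gamma> n 0 = y" "\<And>n. 1 \<le> n \<Longrightarrow> \<gamma> n 1 = y"
    and null: "\<And>U. open U \<Longrightarrow> y \<in> U \<Longrightarrow> finite {n. 1 \<le> n \<and> \<not> path_image (\<gamma> n) \<subseteq> U}"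
  obtains F where "continuous_on earring F" "F b0 = y" "\<And>n t. 1 \<le> n \<Longrightarrow> t \<in> {0..1} \<Longrightarrow> F (ell n t) = \<gamma> n t"
proof -
  define F where "F z = harm.concat_over \<gamma> y (SOME t. t \<in> {0..1} \<and> ell_inf t = z)" for z
  have F: "F (ell n u) = \<gamma> n u" if "1 \<le> n" "u \<in> {0..1}" for n u
  proof -
    have "\<exists>t. t \<in> {0..1} \<and> ell_inf t = ell n u"
      using ell_in_earring[OF that(1), of u] by (metis ell_inf_surj imageE)
    then have T: "(SOME t. t \<in> {0..1} \<and> ell_inf t = ell n u) \<in> {0..1} \<and> ell_inf (SOME t. t \<in> {0..1} \<and> ell_inf t = ell n u) = ell n u"
      by (rule someI_ex)
    have "harm.concat_over ell b0 (SOME t. t \<in> {0..1} \<and> ell_inf t = ell n u) = ell n u"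
      using ell_inf_eq[OF conjunct1[OF T]] conjunct2[OF T] by (rule trans[OF sym])
    then show ?thesis
      unfolding F_def by (rule harm.ell_fibre[OF _ that ends])
  qed
  have Fb: "F b0 = y" using F[of 1 0] ends by simp
  have comp: "F (ell_inf t) = harm.concat_over \<gamma> y t" if "t \<in> {0..1}" for t
  proof (cases "\<exists>n\<ge>1. harm_a n < t \<and> t < harm_b n")
    case True
    then obtain n where n: "1 \<le> n" "harm_a n < t" "t < harm_b n" by blast
    then show ?thesis using that F[of n "(t - harm_a n) / (harm_b n - harm_a n)"]
      by (simp add: ell_inf_eq harm.concat_over_open[OF n])
  next
    case False
    then show ?thesis using that Fb by (simp add: ell_inf_eq harm.concat_over_outside)
  qed
  have "continuous_on earring F"
    unfolding continuous_on_closed_vimage[OF compact_imp_closed[OF compact_earring]]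
  proof (intro allI impI)
    fix B :: "'b set" assume "closed B"
    have c: "continuous_on {0..1} (harm.concat_over \<gamma> y)"
      by (rule harm.continuous_on_concat_over) (use assms in auto)
    have "closed (harm.concat_over \<gamma> y -` B \<inter> {0..1})"
      using c \<open>closed B\<close> by (simp add: continuous_on_closed_vimage)
    then have "compact (harm.concat_over \<gamma> y -` B \<inter> {0..1})"
      using closed_Int_compact[of _ "{0..1}"] by (metis Int_assoc Int_absorb compact_Icc)
    then have "compact (ell_inf ` (harm.concat_over \<gamma> y -` B \<inter> {0..1}))"
      by (rule compact_continuous_image[rotated]) (use path_ell_inf in \<open>auto simp: path_def intro: continuous_on_subset\<close>)
    moreover have "ell_inf ` (harm.concat_over \<gamma> y -` B \<inter> {0..1}) = F -` B \<inter> earring"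
      using comp ell_inf_surj by (auto simp flip: ell_inf_surj)
    ultimately show "closed (F -` B \<inter> earring)" using compact_imp_closed by auto
  qed
  then show ?thesis using that F Fb by blast
qed

lemma earring_self_map_exists:
  assumes loops: "\<And>n. 1 \<le> n \<Longrightarrow> \<gamma> n \<in> loops_at earring b0"
    and null: "\<And>U. open U \<Longrightarrow> b0 \<in> U \<Longrightarrow> finite {n. 1 \<le> n \<and> \<not> path_image (\<gamma> n) \<subseteq> U}"
  obtains F where "continuous_on earring F" "F \<in> earring \<rightarrow> earring" "F b0 = b0"
    "\<And>n t. 1 \<le> n \<Longrightarrow> t \<in> {0..1} \<Longrightarrow> F (ell n t) = \<gamma> n t"
proof -
  obtain F where F: "continuous_on earring F" "F b0 = b0" "\<And>n t. 1 \<le> n \<Longrightarrow> t \<in> {0..1} \<Longrightarrow> F (ell n t) = \<gamma> n t"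
    by (rule earring_map_exists[of \<gamma> b0])
      (use assms in \<open>auto simp: loops_at_def pathstart_def pathfinish_def\<close>)
  have "F z \<in> earring" if z: "z \<in> earring" for z
  proof -
    obtain n t where nt: "1 \<le> n" "t \<in> {0..1}" "z = ell n t" by (rule earring_cases[OF z])
    then have "\<gamma> n t \<in> path_image (\<gamma> n)" by (simp add: path_image_def)
    then show ?thesis using F(3)[OF nt(1,2)] loops[OF nt(1)] nt(3) by (auto simp: loops_at_def)
  qed
  then show thesis using that F by blast
qed

section \<open>Test-closed subgroups in terms of maps on the earring\<close>

lemma path_class_ext: "(\<And>t. t \<in> {0..1} \<Longrightarrow> p t = q t) \<Longrightarrow> path_class X p = path_class X q"
  unfolding path_class_def homotopic_paths by (simp add: pathstart_def pathfinish_def)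

lemma conj_class_ext:
  assumes "\<And>t. t \<in> {0..1} \<Longrightarrow> \<sigma> t = \<sigma>' t" "\<And>t. t \<in> {0..1} \<Longrightarrow> p t = p' t"
  shows "conj_class X \<sigma> p = conj_class X \<sigma>' p'"
  unfolding conj_class_def using assms by (intro path_class_ext) (auto simp: joinpaths_def reversepath_def)

lemma earring_fst:
  assumes "z \<in> earring"
  shows "0 \<le> fst z" "fst z = 0 \<Longrightarrow> z = b0"
proof -
  obtain x y n where z: "z = (x, y)" "1 \<le> n" "(x, y) \<in> hcircle n"
    using assms by (cases z) (auto simp: earring_def)
  then have *: "x\<^sup>2 + y\<^sup>2 = 2 * x / real n" by (simp add: mem_hcircle)
  then have "0 \<le> 2 * x / real n" by (metis sum_power2_ge_zero)
  then show "0 \<le> fst z" using z by (simp add: field_simps)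
  show "z = b0" if "fst z = 0" using that z * by (simp add: b0_def)
qed

lemma b0_plus_in_earring_plus: "b0_plus \<in> earring_plus"
  by (simp add: earring_plus_def b0_plus_def)

lemma whisker_paths_in: "whisker \<in> paths_in earring_plus b0_plus b0"
  unfolding paths_in_def
proof (intro CollectI conjI)
  show "path whisker" unfolding path_def whisker_def by (intro continuous_intros)
qed (auto simp: whisker_def b0_def b0_plus_def earring_plus_def pathstart_def pathfinish_def path_image_def)

lemma loops_at_mono: "S \<subseteq> T \<Longrightarrow> loops_at S x \<subseteq> loops_at T x"
  by (auto simp: loops_at_def)

lemma earring_subset_plus: "earring \<subseteq> earring_plus"
  by (simp add: earring_plus_def)

lemma whiskered_in_carrier:
  assumes "p \<in> loops_at earring b0"
  shows "whiskered p \<in> carrier (pi1 earring_plus b0_plus)"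
proof -
  have "p \<in> loops_at earring_plus b0"
    using assms loops_at_mono[OF earring_subset_plus] by blast
  then show ?thesis
    unfolding whiskered_def by (intro path_class_in_carrier conj_loop[OF whisker_paths_in])
qed

lemma induced_whiskered:
  assumes "based_map earring_plus b0_plus X x0 f" "p \<in> loops_at earring b0"
  shows "induced X f (whiskered p) = conj_class X (f \<circ> whisker) (f \<circ> p)"
proof -
  have "p \<in> loops_at earring_plus b0"
    using assms loops_at_mono[OF earring_subset_plus] by blast
  then have "whisker +++ p +++ reversepath whisker \<in> loops_at earring_plus b0_plus"
    by (rule conj_loop[OF whisker_paths_in])
  then show ?thesis
    unfolding whiskered_def conj_class_def using assms(1)
    by (subst induced_path_class) (auto simp: loops_at_def based_map_def joinpaths_o o_reversepath)
qed

lemma paths_in_compose: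
  assumes "p \<in> paths_in S a b" "continuous_on S f" "f \<in> S \<rightarrow> T"
  shows "f \<circ> p \<in> paths_in T (f a) (f b)"
proof -
  have "path (f \<circ> p)"
    using assms by (intro path_continuous_image) (auto simp: paths_in_def intro: continuous_on_subset)
  then show ?thesis
    using assms by (auto simp: paths_in_def path_image_compose pathstart_compose pathfinish_compose)
qed

text \<open>The earring lies in the half-plane of nonnegative first coordinate and meets the vertical axis only in the
  wedge point, so a path and a map on the earring that agree there can be pasted.\<close>

lemma extend_over_whisker:
  assumes \<sigma>: "\<sigma> \<in> paths_in X x0 (g b0)" and g: "continuous_on earring g" "g \<in> earring \<rightarrow> X"
  obtains f where "based_map earring_plus b0_plus X x0 f" "\<And>t. t \<in> {0..1} \<Longrightarrow> f (whisker t) = \<sigma> t"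
    "\<And>z. z \<in> earring \<Longrightarrow> f z = g z"
proof -
  define f where "f z = (if fst z \<le> 0 then \<sigma> (fst z + 1) else g z)" for z
  have "continuous_on ({-1..0} \<times> {0} \<union> earring) f"
    unfolding f_def
  proof (rule continuous_on_cases)
    show "continuous_on ({-1..0} \<times> {0::real}) (\<lambda>z. \<sigma> (fst z + 1))"
    proof (rule continuous_on_compose2[of "{0..1}" \<sigma>])
      show "continuous_on {0..1} \<sigma>" using \<sigma> by (simp add: paths_in_def path_def)
      show "continuous_on ({-1..0::real} \<times> {0::real}) (\<lambda>z. fst z + 1)" by (intro continuous_intros)
    qed auto
    show "\<forall>z. z \<in> {-1..0} \<times> {0::real} \<and> \<not> fst z \<le> 0 \<or> z \<in> earring \<and> fst z \<le> 0 \<longrightarrow> \<sigma> (fst z + 1) = g z"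
    proof (intro allI impI)
      fix z :: "real \<times> real"
      assume "z \<in> {-1..0} \<times> {0} \<and> \<not> fst z \<le> 0 \<or> z \<in> earring \<and> fst z \<le> 0"
      then have "z = b0" using earring_fst[of z] by fastforce
      then show "\<sigma> (fst z + 1) = g z" using \<sigma> by (simp add: b0_def paths_in_def pathfinish_def)
    qed
  qed (use g compact_earring in \<open>auto intro: closed_Times compact_imp_closed\<close>)
  then have "continuous_on earring_plus f" by (simp add: earring_plus_def Un_commute)
  moreover have fg: "f z = g z" if "z \<in> earring" for z
  proof (cases "fst z \<le> 0")
    case True
    then have "z = b0" using earring_fst[OF that] by simp
    then show ?thesis using \<sigma> by (simp add: f_def b0_def paths_in_def pathfinish_def)
  qed (simp add: f_def)
  moreover have "f z \<in> X" if "z \<in> earring_plus" for z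
  proof (cases "z \<in> earring")
    case True
    then show ?thesis using fg g by auto
  next
    case False
    then have "z \<in> {-1..0} \<times> {0}" using that by (auto simp: earring_plus_def)
    then have "f z = \<sigma> (fst z + 1)" "fst z + 1 \<in> {0..1}" by (auto simp: f_def)
    then show ?thesis using \<sigma> by (auto simp: paths_in_def path_image_def)
  qed
  moreover have "f b0_plus = x0" using \<sigma> by (simp add: f_def b0_plus_def paths_in_def pathstart_def)
  ultimately have "based_map earring_plus b0_plus X x0 f" by (simp add: based_map_def)
  moreover have "f (whisker t) = \<sigma> t" if "t \<in> {0..1}" for t using that by (simp add: f_def whisker_def)
  ultimately show thesis using that[of f] fg by blast
qed

text \<open>A test map splits into its path along the whisker and its restriction to the earring, and any such
  pair with matching ends is glued to a test map. Membership of the image of C is tested on the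
  generators.\<close>

lemma test_closed_iff:
  assumes p: "p \<in> loops_at earring b0"
  shows "test_closed earring_plus b0_plus C_sub (whiskered p) X x0 H \<longleftrightarrow>
    subgroup H (pi1 X x0) \<and>
    (\<forall>\<sigma> g. \<sigma> \<in> paths_in X x0 (g b0) \<longrightarrow> continuous_on earring g \<longrightarrow> g \<in> earring \<rightarrow> X \<longrightarrow>
      (\<forall>n\<ge>1. conj_class X \<sigma> (g \<circ> ell n) \<in> H) \<longrightarrow> conj_class X \<sigma> (g \<circ> p) \<in> H)"
    (is "?L \<longleftrightarrow> ?R")
proof
  assume L: ?L
  then have H: "subgroup H (pi1 X x0)" by (simp add: test_closed_def)
  show ?R
  proof (intro conjI H allI impI)
    fix \<sigma> g
    assume \<sigma>: "\<sigma> \<in> paths_in X x0 (g b0)" and g: "continuous_on earring g" "g \<in> earring \<rightarrow> X"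
      and gens: "\<forall>n\<ge>1. conj_class X \<sigma> (g \<circ> ell n) \<in> H"
    obtain f where f: "based_map earring_plus b0_plus X x0 f" "\<And>t. t \<in> {0..1} \<Longrightarrow> f (whisker t) = \<sigma> t"
      "\<And>z. z \<in> earring \<Longrightarrow> f z = g z"
      using extend_over_whisker[OF \<sigma> g] by blast
    have ind: "induced X f (whiskered q) = conj_class X \<sigma> (g \<circ> q)" if q: "q \<in> loops_at earring b0" for q
    proof -
      have "q t \<in> earring" if "t \<in> {0..1}" for t using that q by (auto simp: loops_at_def path_image_def)
      then show ?thesis
        unfolding induced_whiskered[OF f(1) q] using f by (intro conj_class_ext) auto
    qed
    have "induced X f ` C_sub \<subseteq> H"
      unfolding C_sub_def
    proof (rule induced_generate_subset[OF f(1) b0_plus_in_earring_plus _ H])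
      show "c_elem ` {1..} \<subseteq> carrier (pi1 earring_plus b0_plus)"
        using whiskered_in_carrier ell_loop by (auto simp: c_elem_def)
      show "induced X f ` c_elem ` {1..} \<subseteq> H"
        using gens ind ell_loop by (auto simp: c_elem_def)
    qed
    then have "induced X f (whiskered p) \<in> H" using L f(1) by (simp add: test_closed_def)
    then show "conj_class X \<sigma> (g \<circ> p) \<in> H" using ind[OF p] by simp
  qed
next
  assume R: ?R
  show ?L unfolding test_closed_def
  proof (intro conjI allI impI)
    show "subgroup H (pi1 X x0)" using R by blast
    fix f assume f: "based_map earring_plus b0_plus X x0 f" and C: "induced X f ` C_sub \<subseteq> H"
    have sub: "earring \<subseteq> earring_plus" by (simp add: earring_plus_def)
    have "conj_class X (f \<circ> whisker) (f \<circ> ell n) \<in> H" if n: "1 \<le> n" for n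
    proof -
      have "c_elem n \<in> C_sub" unfolding C_sub_def using n by (intro generate.incl) auto
      then show ?thesis
        using C induced_whiskered[OF f ell_loop[OF n]] by (auto simp: c_elem_def)
    qed
    moreover have "f \<circ> whisker \<in> paths_in X x0 (f b0)"
      using paths_in_compose[OF whisker_paths_in, of f X] f by (simp add: based_map_def)
    moreover have "continuous_on earring f" "f \<in> earring \<rightarrow> X"
      using f sub by (auto simp: based_map_def intro: continuous_on_subset)
    ultimately have "conj_class X (f \<circ> whisker) (f \<circ> p) \<in> H" using R by blast
    then show "induced X f (whiskered p) \<in> H" by (simp add: induced_whiskered[OF f p])
  qed
qed

lemma loops_at_compose_earring:
  assumes "p \<in> loops_at earring b0" "continuous_on earring g" "g \<in> earring \<rightarrow> X"
  shows "g \<circ> p \<in> loops_at X (g b0)"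
  using paths_in_compose[of p earring b0 b0 g X] assms by (simp add: loops_at_eq_paths_in)

text \<open>If \<open>c\<close> is the class of the loop \<open>\<alpha>\<close>, apply closedness of \<open>K\<close> to the path \<open>\<alpha> +++ \<sigma>\<close>.\<close>

lemma test_closed_conjugate:
  assumes x0: "x0 \<in> X" and p: "p \<in> loops_at earring b0"
    and K: "test_closed earring_plus b0_plus C_sub (whiskered p) X x0 K"
    and c: "c \<in> carrier (pi1 X x0)"
  shows "test_closed earring_plus b0_plus C_sub (whiskered p) X x0
     {k \<in> carrier (pi1 X x0). c \<otimes>\<^bsub>pi1 X x0\<^esub> k \<otimes>\<^bsub>pi1 X x0\<^esub> inv\<^bsub>pi1 X x0\<^esub> c \<in> K}" (is "test_closed _ _ _ _ _ _ ?K'")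
proof -
  interpret group "pi1 X x0" by (rule group_pi1[OF x0])
  obtain \<alpha> where \<alpha>: "\<alpha> \<in> loops_at X x0" "c = path_class X \<alpha>" using c unfolding carrier_pi1 by blast
  have K_sub: "subgroup K (pi1 X x0)" using K by (simp add: test_closed_def)
  interpret K: subgroup K "pi1 X x0" by (rule K_sub)
  have "subgroup ?K' (pi1 X x0)"
  proof (rule subgroupI)
    show "?K' \<noteq> {}" using c K.one_closed by (intro ex_in_conv[THEN iffD1] exI[of _ "\<one>\<^bsub>pi1 X x0\<^esub>"]) simp
    fix k assume k: "k \<in> ?K'"
    then have "inv\<^bsub>pi1 X x0\<^esub> (c \<otimes>\<^bsub>pi1 X x0\<^esub> k \<otimes>\<^bsub>pi1 X x0\<^esub> inv\<^bsub>pi1 X x0\<^esub> c) \<in> K" by auto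
    then show "inv\<^bsub>pi1 X x0\<^esub> k \<in> ?K'" using c k by (simp add: inv_mult_group m_assoc)
    fix l assume l: "l \<in> ?K'"
    have "(c \<otimes>\<^bsub>pi1 X x0\<^esub> k \<otimes>\<^bsub>pi1 X x0\<^esub> inv\<^bsub>pi1 X x0\<^esub> c) \<otimes>\<^bsub>pi1 X x0\<^esub> (c \<otimes>\<^bsub>pi1 X x0\<^esub> l \<otimes>\<^bsub>pi1 X x0\<^esub> inv\<^bsub>pi1 X x0\<^esub> c) \<in> K"
      using k l by auto
    moreover have "inv\<^bsub>pi1 X x0\<^esub> c \<otimes>\<^bsub>pi1 X x0\<^esub> (c \<otimes>\<^bsub>pi1 X x0\<^esub> h) = h" if "h \<in> carrier (pi1 X x0)" for h
      using that c by (simp flip: m_assoc)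
    ultimately show "k \<otimes>\<^bsub>pi1 X x0\<^esub> l \<in> ?K'" using c k l by (simp add: m_assoc)
  qed auto
  moreover have "conj_class X \<sigma> (g \<circ> p) \<in> ?K'"
    if \<sigma>: "\<sigma> \<in> paths_in X x0 (g b0)" and g: "continuous_on earring g" "g \<in> earring \<rightarrow> X"
      and gens: "\<forall>n\<ge>1. conj_class X \<sigma> (g \<circ> ell n) \<in> ?K'" for \<sigma> g
  proof -
    have conj: "conj_class X (\<alpha> +++ \<sigma>) (g \<circ> q) = c \<otimes>\<^bsub>pi1 X x0\<^esub> conj_class X \<sigma> (g \<circ> q) \<otimes>\<^bsub>pi1 X x0\<^esub> inv\<^bsub>pi1 X x0\<^esub> c"
      if "q \<in> loops_at earring b0" for q
      unfolding \<alpha>(2) by (rule conj_class_prepend_loop[OF \<sigma> \<alpha>(1) loops_at_compose_earring[OF that g]])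
    have "\<alpha> +++ \<sigma> \<in> paths_in X x0 (g b0)"
      using \<alpha>(1) \<sigma> by (auto simp: loops_at_eq_paths_in)
    moreover have "\<forall>n\<ge>1. conj_class X (\<alpha> +++ \<sigma>) (g \<circ> ell n) \<in> K"
      using gens conj ell_loop by auto
    ultimately have "conj_class X (\<alpha> +++ \<sigma>) (g \<circ> p) \<in> K"
      using K g unfolding test_closed_iff[OF p] by blast
    then show ?thesis
      using conj[OF p] conj_class_in_carrier[OF \<sigma> loops_at_compose_earring[OF p g]] by simp
  qed
  ultimately show ?thesis unfolding test_closed_iff[OF p] by blast
qed

lemma test_closed_carrier:
  assumes "x0 \<in> X" "p \<in> loops_at earring b0"
  shows "test_closed earring_plus b0_plus C_sub (whiskered p) X x0 (carrier (pi1 X x0))"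
  unfolding test_closed_iff[OF assms(2)]
  using conj_class_in_carrier loops_at_compose_earring[OF assms(2)] group.subgroup_self[OF group_pi1[OF assms(1)]]
  by blast

lemma test_closed_closure:
  assumes x0: "x0 \<in> X" and p: "p \<in> loops_at earring b0" and N: "N \<subseteq> carrier (pi1 X x0)"
  shows "test_closed earring_plus b0_plus C_sub (whiskered p) X x0
          (test_closure earring_plus b0_plus C_sub (whiskered p) X x0 N)"
proof -
  have "subgroup (test_closure earring_plus b0_plus C_sub (whiskered p) X x0 N) (pi1 X x0)"
    unfolding test_closure_def
    by (rule group.subgroups_Inter[OF group_pi1[OF x0]])
      (use test_closed_carrier[OF x0 p] N in \<open>auto simp: test_closed_def\<close>)
  then show ?thesis
    unfolding test_closed_def test_closure_def by blast
qed

text \<open>Conjugation permutes the closed subgroups that contain the normal subgroup \<open>N\<close>.\<close>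

lemma test_closure_normal:
  assumes x0: "x0 \<in> X" and p: "p \<in> loops_at earring b0" and N: "N \<lhd> pi1 X x0"
  shows "test_closure earring_plus b0_plus C_sub (whiskered p) X x0 N \<lhd> pi1 X x0" (is "?cl \<lhd> _")
proof -
  interpret N: normal N "pi1 X x0" by (rule N)
  have "subgroup ?cl (pi1 X x0)"
    using test_closed_closure[OF x0 p N.subset] by (simp add: test_closed_def)
  moreover have "c \<otimes>\<^bsub>pi1 X x0\<^esub> h \<otimes>\<^bsub>pi1 X x0\<^esub> inv\<^bsub>pi1 X x0\<^esub> c \<in> ?cl"
    if c: "c \<in> carrier (pi1 X x0)" and h: "h \<in> ?cl" for c h
    unfolding test_closure_def
  proof clarify
    fix K assume K: "test_closed earring_plus b0_plus C_sub (whiskered p) X x0 K" "N \<subseteq> K"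
    have "N \<subseteq> {k \<in> carrier (pi1 X x0). c \<otimes>\<^bsub>pi1 X x0\<^esub> k \<otimes>\<^bsub>pi1 X x0\<^esub> inv\<^bsub>pi1 X x0\<^esub> c \<in> K}"
      using K(2) N.subset N.inv_op_closed2[OF c] by blast
    with test_closed_conjugate[OF x0 p K(1) c] h
    show "c \<otimes>\<^bsub>pi1 X x0\<^esub> h \<otimes>\<^bsub>pi1 X x0\<^esub> inv\<^bsub>pi1 X x0\<^esub> c \<in> K"
      unfolding test_closure_def by blast
  qed
  ultimately show ?thesis by (simp add: N.normal_inv_iff)
qed

section \<open>The gaps of the Cantor set\<close>

lemma mem_cantor_stage_Suc: "y \<in> cantor_stage (Suc m) \<longleftrightarrow> 3 * y \<in> cantor_stage m \<or> 3 * y - 2 \<in> cantor_stage m"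
proof -
  have "y \<in> (\<lambda>x. x / 3) ` S \<longleftrightarrow> 3 * y \<in> S" for S :: "real set"
  proof
    assume "3 * y \<in> S"
    then show "y \<in> (\<lambda>x. x / 3) ` S" by (intro image_eqI[of _ _ "3 * y"]) auto
  qed auto
  moreover have "y \<in> (\<lambda>x. 2 / 3 + x / 3) ` S \<longleftrightarrow> 3 * y - 2 \<in> S" for S :: "real set"
  proof
    assume "3 * y - 2 \<in> S"
    then show "y \<in> (\<lambda>x. 2 / 3 + x / 3) ` S" by (intro image_eqI[of _ _ "3 * y - 2"]) (auto simp: diff_divide_distrib)
  qed auto
  ultimately show ?thesis by simp
qed

text \<open>Gaps are recorded by their left end points. The level \<open>m\<close> starts at 0, so the gaps of level \<open>m\<close> have
  length \<open>1 / 3 ^ (m + 1)\<close> and are those removed in passing from stage \<open>m\<close> to stage \<open>m + 1\<close>.\<close>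

fun gap_lefts :: "nat \<Rightarrow> real set" where
  "gap_lefts 0 = {1 / 3}"
| "gap_lefts (Suc m) = (\<lambda>x. x / 3) ` gap_lefts m \<union> (\<lambda>x. 2 / 3 + x / 3) ` gap_lefts m"

definition gap :: "nat \<Rightarrow> real \<Rightarrow> real set" where
  "gap m x = {x<..<x + 1 / 3 ^ Suc m}"

lemma cantor_stage_subset: "cantor_stage m \<subseteq> {0..1}"
  by (induction m) fastforce+

text \<open>The two contractions that generate the Cantor set carry the set removed at one step onto the set
  removed at the next, because their images are disjoint.\<close>

lemma cantor_stage_diff: "cantor_stage m - cantor_stage (Suc m) = (\<Union>x\<in>gap_lefts m. gap m x)"
proof (induction m)
  case 0
  show ?case by (auto simp: gap_def mem_cantor_stage_Suc simp del: cantor_stage.simps(2))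
next
  case (Suc m)
  have gaps: "y \<in> (\<Union>x\<in>gap_lefts (Suc m). gap (Suc m) x) \<longleftrightarrow>
    3 * y \<in> (\<Union>x\<in>gap_lefts m. gap m x) \<or> 3 * y - 2 \<in> (\<Union>x\<in>gap_lefts m. gap m x)" for y
  proof -
    have "y \<in> gap (Suc m) (x / 3) \<longleftrightarrow> 3 * y \<in> gap m x" "y \<in> gap (Suc m) (2 / 3 + x / 3) \<longleftrightarrow> 3 * y - 2 \<in> gap m x" for x
      by (auto simp: gap_def field_simps)
    then show ?thesis by auto
  qed
  have "3 * y \<notin> {0..1} \<or> 3 * y - 2 \<notin> {0..1}" for y :: real by auto
  then have no: "\<not> (3 * y \<in> cantor_stage k \<and> 3 * y - 2 \<in> cantor_stage l)" for y k l
    using cantor_stage_subset by blast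
  show ?case
  proof (rule Set.set_eqI)
    fix y
    show "y \<in> cantor_stage (Suc m) - cantor_stage (Suc (Suc m)) \<longleftrightarrow> y \<in> (\<Union>x\<in>gap_lefts (Suc m). gap (Suc m) x)"
      unfolding gaps Suc.IH[symmetric] Diff_iff
      using mem_cantor_stage_Suc[of y m] mem_cantor_stage_Suc[of y "Suc m"] no[of y m "Suc m"] no[of y "Suc m" m] by blast
  qed
qed

lemma cantor_set_complement: "{0..1} - cantor_set = (\<Union>m. \<Union>x\<in>gap_lefts m. gap m x)"
proof -
  have "{0..1} - cantor_set \<subseteq> (\<Union>m. cantor_stage m - cantor_stage (Suc m))"
  proof
    fix t assume "t \<in> {0..1} - cantor_set"
    show "t \<in> (\<Union>m. cantor_stage m - cantor_stage (Suc m))"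
    proof (rule ccontr)
      assume "t \<notin> (\<Union>m. cantor_stage m - cantor_stage (Suc m))"
      then have step: "t \<in> cantor_stage m \<Longrightarrow> t \<in> cantor_stage (Suc m)" for m by blast
      have "t \<in> cantor_stage 0" using \<open>t \<in> {0..1} - cantor_set\<close> by simp
      then have "t \<in> cantor_stage m" for m by (induction m) (use step in blast)+
      then show False using \<open>t \<in> {0..1} - cantor_set\<close> by (simp add: cantor_set_def)
    qed
  qed
  moreover have "(\<Union>m. cantor_stage m - cantor_stage (Suc m)) \<subseteq> {0..1} - cantor_set"
    using cantor_stage_subset by (force simp: cantor_set_def simp del: cantor_stage.simps)
  ultimately have "{0..1} - cantor_set = (\<Union>m. cantor_stage m - cantor_stage (Suc m))" by (rule equalityI)
  then show ?thesis unfolding cantor_stage_diff .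
qed

lemma cantor_set_contract:
  assumes "y \<in> cantor_set"
  shows "y / 3 \<in> cantor_set" "2 / 3 + y / 3 \<in> cantor_set"
proof -
  have y: "y \<in> cantor_stage m" for m using assms by (simp add: cantor_set_def)
  have "y / 3 \<in> cantor_stage m \<and> 2 / 3 + y / 3 \<in> cantor_stage m" for m
    using y[of 0] y[of "m - 1"] by (cases m) auto
  then show "y / 3 \<in> cantor_set" "2 / 3 + y / 3 \<in> cantor_set" by (auto simp: cantor_set_def)
qed

lemma zero_one_in_cantor_set: "0 \<in> cantor_set" "1 \<in> cantor_set"
proof -
  have "0 \<in> cantor_stage m \<and> 1 \<in> cantor_stage m" for m
    by (induction m) (auto simp: mem_cantor_stage_Suc simp del: cantor_stage.simps(2))
  then show "0 \<in> cantor_set" "1 \<in> cantor_set" by (auto simp: cantor_set_def)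
qed

lemma gap_ends_in_cantor_set: "x \<in> gap_lefts m \<Longrightarrow> x \<in> cantor_set \<and> x + 1 / 3 ^ Suc m \<in> cantor_set"
proof (induction m arbitrary: x)
  case 0
  then have x: "x = 1 / 3" by simp
  show ?case
    unfolding x using cantor_set_contract(2)[OF zero_one_in_cantor_set(1)] cantor_set_contract(1)[OF zero_one_in_cantor_set(2)]
    by simp
next
  case (Suc m)
  then consider z where "z \<in> gap_lefts m" "x = z / 3" | z where "z \<in> gap_lefts m" "x = 2 / 3 + z / 3" by auto
  then show ?case
  proof cases
    case 1
    then show ?thesis using Suc.IH[of z] cantor_set_contract(1)[of z] cantor_set_contract(1)[of "z + 1 / 3 ^ Suc m"]
      unfolding 1(2) by (simp add: add_divide_distrib mult.commute)
  next
    case 2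
    then show ?thesis using Suc.IH[of z] cantor_set_contract(2)[of z] cantor_set_contract(2)[of "z + 1 / 3 ^ Suc m"]
      unfolding 2(2) by (simp add: add_divide_distrib mult.commute add.assoc)
  qed
qed

text \<open>The end points of a gap belong to the Cantor set, so a connected subset of the complement that
  contains the gap cannot leave it.\<close>

lemma gap_component:
  assumes "x \<in> gap_lefts m"
  shows "gap m x \<in> components ({0..1} - cantor_set)"
  unfolding in_components_maximal
proof (intro conjI allI impI)
  show "gap m x \<noteq> {}" by (simp add: gap_def not_le)
  show "gap m x \<subseteq> {0..1} - cantor_set" unfolding cantor_set_complement using assms by blast
  show "connected (gap m x)" by (simp add: gap_def)
  fix d assume d: "d \<noteq> {} \<and> gap m x \<subseteq> d \<and> d \<subseteq> {0..1} - cantor_set \<and> connected d"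
  define \<delta> :: real where "\<delta> = 1 / 3 ^ Suc m"
  \<comment> \<open>A point of the gap, from which to any point outside one has to cross an end point.\<close>
  define w where "w = x + \<delta> / 2"
  have "0 < \<delta>" by (simp add: \<delta>_def)
  then have w: "w \<in> d" "x < w" "w < x + \<delta>" using d by (auto simp: gap_def w_def \<delta>_def[symmetric] subset_iff simp del: power_Suc)
  have "x \<notin> d" "x + \<delta> \<notin> d" using gap_ends_in_cantor_set[OF assms] d unfolding \<delta>_def by auto
  moreover have "x \<in> d" if "z \<in> d" "z \<le> x" for z
    using connected_contains_Icc[of d z w] that w d by (auto simp: subset_iff)
  moreover have "x + \<delta> \<in> d" if "z \<in> d" "x + \<delta> \<le> z" for z
    using connected_contains_Icc[of d w z] that w d by (auto simp: subset_iff)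
  ultimately have "d \<subseteq> gap m x" unfolding gap_def \<delta>_def by (metis greaterThanLessThan_iff not_le subsetI)
  then show "d = gap m x" using d by blast
qed

lemma gap_Inf_Sup: "Inf (gap m x) = x" "Sup (gap m x) = x + 1 / 3 ^ Suc m"
  by (simp_all add: gap_def)

lemma gap_overlap:
  assumes "x \<in> gap_lefts m" "y \<in> gap_lefts n" "t \<in> gap m x" "t \<in> gap n y"
  shows "m = n \<and> x = y"
proof -
  have eq: "gap m x = gap n y"
    using components_nonoverlap[OF gap_component[OF assms(1)] gap_component[OF assms(2)]] assms by blast
  then have "x = y" "x + 1 / 3 ^ Suc m = y + 1 / 3 ^ Suc n" by (metis gap_Inf_Sup)+
  then have "(3 :: real) ^ Suc m = 3 ^ Suc n" by simp
  then have "m = n" by (simp only: power_inject_exp)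
  with \<open>x = y\<close> show ?thesis by simp
qed

lemma components_cantor_complement: "components ({0..1} - cantor_set) = (\<Union>m. gap m ` gap_lefts m)"
proof
  show "components ({0..1} - cantor_set) \<subseteq> (\<Union>m. gap m ` gap_lefts m)"
  proof
    fix c assume c: "c \<in> components ({0..1} - cantor_set)"
    then obtain t where t: "t \<in> c" using in_components_nonempty by blast
    then have "t \<in> {0..1} - cantor_set" using c in_components_subset by blast
    then obtain m x where "x \<in> gap_lefts m" "t \<in> gap m x" unfolding cantor_set_complement by blast
    moreover from this have "c = gap m x"
      using components_nonoverlap[OF c gap_component[of x m]] t by blast
    ultimately show "c \<in> (\<Union>m. gap m ` gap_lefts m)" by blast
  qed
qed (use gap_component in blast)

lemma cantor_gaps_Suc: "cantor_gaps (Suc m) = gap m ` gap_lefts m"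
proof -
  have "(1 :: real) / 3 ^ Suc k = 1 / 3 ^ Suc m \<longleftrightarrow> k = m" for k
    by (simp del: power_Suc) 
  then show ?thesis
    unfolding cantor_gaps_def components_cantor_complement by (auto simp: gap_Inf_Sup simp del: power_Suc)
qed

lemma gap_lefts_bounds: "x \<in> gap_lefts m \<Longrightarrow> 0 \<le> x \<and> x \<le> 1 - 2 / 3 ^ Suc m"
proof (induction m arbitrary: x)
  case (Suc m)
  have e: "2 / 3 ^ Suc (Suc m) = (2 / 3 ^ Suc m :: real) / 3" "(0::real) \<le> 2 / 3 ^ Suc m" by auto
  from Suc.prems consider z where "z \<in> gap_lefts m" "x = z / 3" | z where "z \<in> gap_lefts m" "x = 2 / 3 + z / 3" by auto
  then show ?case
  proof cases
    case 1
    then show ?thesis using Suc.IH[of z] unfolding e(1) by (simp del: power_Suc)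
  next
    case 2
    then show ?thesis using Suc.IH[of z] unfolding e(1) by (simp del: power_Suc)
  qed
qed auto

text \<open>Together with \<open>gap_lefts_bounds\<close>, this identifies the rightmost gap of each level.\<close>

lemma last_gap_left: "1 - 2 / 3 ^ Suc m \<in> gap_lefts m"
proof (induction m)
  case (Suc m)
  have "1 - 2 / 3 ^ Suc (Suc m) = 2 / 3 + (1 - 2 / 3 ^ Suc m) / (3::real)" by (simp add: field_simps)
  then show ?case using Suc by (metis UnCI gap_lefts.simps(2) imageI)
qed simp

lemma finite_gap_lefts: "finite (gap_lefts m)"
  by (induction m) auto

lemma card_gap_lefts: "card (gap_lefts m) = 2 ^ m"
proof (induction m)
  case (Suc m)
  have "x / 3 \<noteq> 2 / 3 + y / 3" if "x \<in> gap_lefts m" "y \<in> gap_lefts m" for x y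
  proof -
    have "x \<le> 1 - 2 / 3 ^ Suc m" "0 \<le> y" using that gap_lefts_bounds by blast+
    moreover have "(0::real) \<le> 2 / 3 ^ Suc m" by simp
    ultimately show ?thesis by linarith
  qed
  then have "((\<lambda>x. x / 3) ` gap_lefts m) \<inter> ((\<lambda>x. 2 / 3 + x / 3) ` gap_lefts m) = {}" by blast
  then show ?case
    using Suc finite_gap_lefts[of m] by (simp add: card_Un_disjoint card_image inj_on_def)
qed simp

lemma gap_lefts_enumeration:
  obtains A where "\<And>m. bij_betw (A m) {..<2 ^ m :: nat} (gap_lefts m)" "\<And>m. strict_mono_on {..<2 ^ m :: nat} (A m)"
proof -
  have "\<exists>h. bij_betw h {..<2 ^ m :: nat} (gap_lefts m) \<and> strict_mono_on {..<2 ^ m :: nat} h" for m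
  proof -
    let ?xs = "sorted_list_of_set (gap_lefts m)"
    have len: "length ?xs = 2 ^ m" by (simp add: card_gap_lefts)
    have "bij_betw ((!) ?xs) {..<2 ^ m :: nat} (gap_lefts m)"
      by (rule bij_betw_nth) (use len finite_gap_lefts in auto)
    moreover have "strict_mono_on {..<2 ^ m :: nat} ((!) ?xs)"
      using sorted_wrt_nth_less[OF sorted_list_of_set.strict_sorted_key_list_of_set[of "gap_lefts m"]] len
      by (auto intro!: strict_mono_onI)
    ultimately show ?thesis by blast
  qed
  then show thesis using that by metis
qed

text \<open>In an increasing enumeration that starts at 0, the entry with index \<open>i\<close> has exactly \<open>i + 1\<close> entries to
  its left, itself included; so counting gaps from the left recovers the enumeration.\<close>

lemma cantor_gap_eq:
  assumes bij: "bij_betw h {..<2 ^ m :: nat} (gap_lefts m)" and mono: "strict_mono_on {..<2 ^ m :: nat} h" and i: "i < 2 ^ m"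
  shows "cantor_gap (Suc m) (Suc i) = gap m (h i)"
  unfolding cantor_gap_def
proof (rule the_equality)
  have im: "gap_lefts m = h ` {..<2 ^ m :: nat}" and inj: "inj_on h {..<2 ^ m :: nat}" using bij by (auto simp: bij_betw_def)
  have rank: "card {J \<in> cantor_gaps (Suc m). Inf J \<le> Inf (gap m (h j))} = Suc j" if j: "j < 2 ^ m" for j
  proof -
    have "h k \<le> h j \<longleftrightarrow> k \<le> j" if "k < 2 ^ m" for k
      using strict_mono_on_less_eq[OF mono, of k j] that j by simp
    then have "{J \<in> cantor_gaps (Suc m). Inf J \<le> Inf (gap m (h j))} = (\<lambda>k. gap m (h k)) ` {..j}"
      using j by (force simp: cantor_gaps_Suc gap_Inf_Sup im)
    moreover have "inj_on (\<lambda>k. gap m (h k)) {..j}"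
    proof (rule inj_onI)
      fix k l assume "k \<in> {..j}" "l \<in> {..j}" "gap m (h k) = gap m (h l)"
      then show "k = l" using inj j by (metis (no_types) gap_Inf_Sup(1) inj_onD lessThan_iff atMost_iff order_le_less_trans)
    qed
    ultimately show ?thesis by (simp add: card_image)
  qed
  show "gap m (h i) \<in> cantor_gaps (Suc m) \<and> card {J \<in> cantor_gaps (Suc m). Inf J \<le> Inf (gap m (h i))} = Suc i"
    using rank[OF i] i by (simp add: cantor_gaps_Suc im)
  fix I assume I: "I \<in> cantor_gaps (Suc m) \<and> card {J \<in> cantor_gaps (Suc m). Inf J \<le> Inf I} = Suc i"
  then obtain j where j: "j < 2 ^ m" "I = gap m (h j)" by (auto simp: cantor_gaps_Suc im)
  then show "I = gap m (h i)" using I rank[OF j(1)] by simp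
qed

text \<open>With \<open>n = m + 1\<close> and \<open>k = i + 1\<close>, the index \<open>2 ^ (n - 1) + k - 1\<close> of the circle attached to the \<open>k\<close>-th gap
  of length \<open>1 / 3 ^ n\<close> is \<open>2 ^ m + i\<close>.\<close>

lemma dyadic_index:
  assumes "1 \<le> (N::nat)"
  obtains m i where "i < 2 ^ m" "N = 2 ^ m + i"
proof -
  obtain m where m: "2 ^ m \<le> N" "N < 2 ^ (m + 1)" using ex_power_ivl1[of 2 N] assms by auto
  then show thesis using that[of "N - 2 ^ m" m] by simp
qed

lemma dyadic_index_unique:
  assumes "i < 2 ^ m" "j < 2 ^ n" "2 ^ m + i = 2 ^ n + (j::nat)"
  shows "m = n \<and> i = j"
proof -
  have "m = n"
  proof (rule ccontr)
    assume "m \<noteq> n"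
    then consider "Suc m \<le> n" | "Suc n \<le> m" by linarith
    then show False
    proof cases
      case 1
      then have "(2::nat) ^ Suc m \<le> 2 ^ n" by (rule power_increasing) simp
      then show False using assms by simp
    next
      case 2
      then have "(2::nat) ^ Suc n \<le> 2 ^ m" by (rule power_increasing) simp
      then show False using assms by simp
    qed
  qed
  then show ?thesis using assms by simp
qed

text \<open>The last two conclusions locate the rightmost gap of level \<open>m\<close>: its rank among the gaps of its length is
  \<open>2 ^ m\<close>, so its circle has index \<open>2 ^ m + 2 ^ m - 1\<close>.\<close>

lemma ell_tau_gaps:
  obtains a b where "gap_family a b"
    "\<And>t. t \<in> {0..1} \<Longrightarrow> ell_tau t = gap_family.concat_over a b ell b0 t"
    "\<And>m. a (2 ^ Suc m - 1) = 1 - 2 / 3 ^ Suc m" "\<And>m. b (2 ^ Suc m - 1) = 1 - 1 / 3 ^ Suc m"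
proof -
  obtain A where bij: "\<And>m. bij_betw (A m) {..<2 ^ m :: nat} (gap_lefts m)" and mono: "\<And>m. strict_mono_on {..<2 ^ m :: nat} (A m)"
    by (rule gap_lefts_enumeration) blast
  have A_in: "A m i \<in> gap_lefts m" if "i < 2 ^ m" for m and i :: nat
    using bij[of m] that by (auto simp: bij_betw_def)
  define q where "q N = (SOME q :: nat \<times> nat. snd q < 2 ^ fst q \<and> N = 2 ^ fst q + snd q)" for N :: nat
  define lv ix where "lv N = fst (q N)" and "ix N = snd (q N)" for N
  have N: "ix N < 2 ^ lv N \<and> N = 2 ^ lv N + ix N" if N1: "1 \<le> N" for N :: nat
  proof -
    obtain i m where "i < 2 ^ m" "N = 2 ^ m + i" by (rule dyadic_index[OF N1])
    then have "\<exists>q :: nat \<times> nat. snd q < 2 ^ fst q \<and> N = 2 ^ fst q + snd q"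
      by (intro exI[of _ "(m, i)"]) simp
    then show ?thesis unfolding lv_def ix_def q_def by (rule someI_ex)
  qed
  have lvix: "lv (2 ^ m + i) = m \<and> ix (2 ^ m + i) = i" if "i < 2 ^ m" for m i
    using dyadic_index_unique[of "ix (2 ^ m + i)" "lv (2 ^ m + i)" i m] N[of "2 ^ m + i"] that by auto
  define a where "a N = A (lv N) (ix N)" for N
  define b where "b N = a N + 1 / 3 ^ Suc (lv N)" for N
  have mem: "t \<in> gap (lv N) (a N) \<longleftrightarrow> a N < t \<and> t < b N" for t N by (simp add: gap_def b_def)
  have a_in: "a N \<in> gap_lefts (lv N)" if "1 \<le> N" for N using N[OF that] A_in by (simp add: a_def)
  have uniq: "M = N" if "1 \<le> M" "1 \<le> N" "t \<in> gap (lv M) (a M)" "t \<in> gap (lv N) (a N)" for M N t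
  proof -
    have "lv M = lv N" "a M = a N" using gap_overlap[OF a_in a_in that(3,4)] that by auto
    then have "ix M = ix N"
      using bij[of "lv N"] N[OF that(1)] N[OF that(2)] by (auto simp: a_def bij_betw_def inj_on_def)
    then show ?thesis using N[OF that(1)] N[OF that(2)] \<open>lv M = lv N\<close> by simp
  qed
  interpret G: gap_family a b
  proof
    show "0 \<le> a N" "b N \<le> 1" if "1 \<le> N" for N
      using gap_ends_in_cantor_set[OF a_in[OF that]] unfolding b_def cantor_set_def by (force dest: spec[of _ 0])+
    show "a N < b N" for N by (simp add: b_def)
  qed (use uniq mem in blast)
  have "ell_tau t = G.concat_over ell b0 t" if t: "t \<in> {0..1}" for t
  proof (cases "\<exists>N\<ge>1. a N < t \<and> t < b N")
    case True
    then obtain N where N1: "1 \<le> N" and tN: "a N < t" "t < b N" by blast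
    define m i where "m = lv N" and "i = ix N"
    have i: "i < 2 ^ m" and Nmi: "N = 2 ^ m + i" using N[OF N1] by (auto simp: m_def i_def)
    have cg: "cantor_gap (Suc m) (Suc i) = gap m (a N)"
      unfolding a_def m_def[symmetric] i_def[symmetric] by (rule cantor_gap_eq[OF bij mono i])
    have tg: "t \<in> gap m (a N)" using tN by (simp add: mem m_def)
    have the: "(THE (n, k). 1 \<le> n \<and> 1 \<le> k \<and> k \<le> 2 ^ (n - 1) \<and> t \<in> cantor_gap n k) = (Suc m, Suc i)"
    proof (rule the_equality)
      show "case (Suc m, Suc i) of (n, k) \<Rightarrow> 1 \<le> n \<and> 1 \<le> k \<and> k \<le> 2 ^ (n - 1) \<and> t \<in> cantor_gap n k"
        using i cg tg by simp
      fix x :: "nat \<times> nat" assume x: "case x of (n, k) \<Rightarrow> 1 \<le> n \<and> 1 \<le> k \<and> k \<le> 2 ^ (n - 1) \<and> t \<in> cantor_gap n k"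
      define n k where "n = fst x - 1" and "k = snd x - 1"
      have nk: "x = (Suc n, Suc k)" using x by (simp add: n_def k_def prod_eq_iff case_prod_beta)
      with x have k: "k < 2 ^ n" and "t \<in> cantor_gap (Suc n) (Suc k)" by auto
      then have tk: "t \<in> gap n (A n k)" using cantor_gap_eq[OF bij mono k] by simp
      have "n = m \<and> A n k = a N"
        using gap_overlap[OF A_in[OF k] a_in[OF N1] tk] tg unfolding m_def by blast
      moreover from this have "k = i"
        using bij[of m] k i by (auto simp: a_def m_def[symmetric] i_def[symmetric] bij_betw_def inj_on_def)
      ultimately show "x = (Suc m, Suc i)" using nk by simp
    qed
    have "t \<in> {0..1} - cantor_set"
      unfolding cantor_set_complement using tg a_in[OF N1] by (auto simp: m_def)
    moreover have "Sup (cantor_gap (Suc m) (Suc i)) = b N" "Inf (cantor_gap (Suc m) (Suc i)) = a N"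
      unfolding cg gap_Inf_Sup by (simp_all add: b_def m_def)
    moreover have "2 ^ (Suc m - 1) + Suc i - 1 = N" using Nmi by simp
    ultimately have "ell_tau t = ell N ((t - a N) / (b N - a N))"
      unfolding ell_tau_def the by (simp only: if_True prod.case Let_def)
    then show ?thesis unfolding G.concat_over_open[OF N1 tN] .
  next
    case False
    have "t \<notin> {0..1} - cantor_set"
    proof
      assume "t \<in> {0..1} - cantor_set"
      then obtain m x where mx: "x \<in> gap_lefts m" "t \<in> gap m x" unfolding cantor_set_complement by blast
      then obtain i where i: "i < 2 ^ m" "x = A m i" using bij[of m] by (auto simp: bij_betw_def)
      then have "t \<in> gap (lv (2 ^ m + i)) (a (2 ^ m + i))" using lvix[OF i(1)] mx by (simp add: a_def)
      then have "a (2 ^ m + i) < t \<and> t < b (2 ^ m + i)" unfolding mem .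
      moreover have "1 \<le> (2::nat) ^ m + i" by (simp add: trans_le_add1)
      ultimately show False using False by blast
    qed
    then have "ell_tau t = b0" unfolding ell_tau_def by (rule if_not_P)
    then show ?thesis using False by (simp add: G.concat_over_outside)
  qed
  moreover have last_gap: "a (2 ^ Suc m - 1) = 1 - 2 / 3 ^ Suc m \<and> lv (2 ^ Suc m - 1) = m" for m
  proof -
    define j :: nat where "j = 2 ^ m - 1"
    have j: "j < 2 ^ m" and eq: "(2::nat) ^ Suc m - 1 = 2 ^ m + j" by (auto simp: j_def)
    obtain i where i: "i < 2 ^ m" "A m i = 1 - 2 / 3 ^ Suc m"
      using last_gap_left[of m] bij[of m] by (auto simp: bij_betw_def simp del: power_Suc) (metis imageE lessThan_iff)
    have "A m j \<le> A m i" using gap_lefts_bounds[OF A_in[OF j]] i(2) by simp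
    then have "j \<le> i" using strict_mono_on_less_eq[OF mono[of m], of j i] i j by simp
    then have "i = j" using i by (simp add: j_def)
    then show ?thesis using lvix[OF j] i(2) unfolding eq by (simp add: a_def)
  qed
  moreover have "b (2 ^ Suc m - 1) = 1 - 1 / 3 ^ Suc m" for m
    using last_gap[of m] unfolding b_def by (simp del: power_Suc)
  ultimately show thesis using that G.gap_family_axioms by blast
qed

lemma ell_tau_loop: "ell_tau \<in> loops_at earring b0"
proof -
  obtain a b where G: "gap_family a b" and tau: "\<And>t. t \<in> {0..1} \<Longrightarrow> ell_tau t = gap_family.concat_over a b ell b0 t"
    by (rule ell_tau_gaps) blast
  show ?thesis
  proof (rule loops_at_ext)
    show "gap_family.concat_over a b ell b0 \<in> loops_at earring b0"
      by (intro gap_family.concat_over_loop[OF G] ell_loop b0_in_earring ell_null)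
  qed (simp add: tau)
qed

section \<open>The infinite concatenation as an image of the Cantor loop\<close>

text \<open>The circles attached to the rightmost gap of each length are those of index \<open>2 ^ n - 1\<close>; only these are
  kept, renumbered by \<open>n\<close>.\<close>

definition thinned :: "nat \<Rightarrow> real \<Rightarrow> real \<times> real" where
  "thinned m = (if \<exists>n\<ge>1. m = 2 ^ n - 1 then ell (THE n. 1 \<le> n \<and> m = 2 ^ n - 1) else (\<lambda>t. b0))"

lemma thinned_mersenne:
  assumes "1 \<le> n"
  shows "thinned (2 ^ n - 1) = ell n"
proof -
  have "(THE k. 1 \<le> k \<and> (2::nat) ^ n - 1 = 2 ^ k - 1) = n"
  proof (rule the_equality)
    fix k assume k: "1 \<le> k \<and> (2::nat) ^ n - 1 = 2 ^ k - 1"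
    have "(2::nat) ^ n = Suc (2 ^ n - 1)" "(2::nat) ^ k = Suc (2 ^ k - 1)" by simp_all
    then have "(2::nat) ^ n = 2 ^ k" using k by metis
    then show "k = n" by simp
  qed (use assms in simp)
  then show ?thesis using assms unfolding thinned_def by auto
qed

lemma thinned_cases:
  obtains n where "1 \<le> n" "m = 2 ^ n - 1" "thinned m = ell n" | "thinned m = (\<lambda>t. b0)" "\<And>n. 1 \<le> n \<Longrightarrow> m \<noteq> 2 ^ n - 1"
proof (cases "\<exists>n\<ge>1. m = 2 ^ n - 1")
  case True
  then obtain n where "1 \<le> n" "m = 2 ^ n - 1" by blast
  then show thesis using that(1)[of n] thinned_mersenne[of n] by simp
next
  case False
  have "thinned m = (\<lambda>t. b0)" unfolding thinned_def by (rule if_not_P[OF False])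
  then show thesis using that(2) False by blast
qed

lemma thinned_loop: "thinned m \<in> loops_at earring b0"
  by (cases rule: thinned_cases[of m]) (simp_all add: ell_loop loops_at_const b0_in_earring)

lemma thinned_null:
  assumes "open U" "b0 \<in> U"
  shows "finite {m. 1 \<le> m \<and> \<not> path_image (thinned m) \<subseteq> U}"
proof (rule finite_subset)
  show "finite ((\<lambda>n. 2 ^ n - 1) ` {n. 1 \<le> n \<and> \<not> path_image (ell n) \<subseteq> U} :: nat set)"
    using ell_null[OF assms] by (rule finite_imageI)
  show "{m. 1 \<le> m \<and> \<not> path_image (thinned m) \<subseteq> U} \<subseteq> (\<lambda>n. 2 ^ n - 1) ` {n. 1 \<le> n \<and> \<not> path_image (ell n) \<subseteq> U}"
  proof
    fix m assume m: "m \<in> {m. 1 \<le> m \<and> \<not> path_image (thinned m) \<subseteq> U}"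
    show "m \<in> (\<lambda>n. 2 ^ n - 1) ` {n. 1 \<le> n \<and> \<not> path_image (ell n) \<subseteq> U}"
    proof (cases rule: thinned_cases[of m])
      case (1 n)
      then show ?thesis using m by auto
    next
      case 2
      then show ?thesis using m assms by simp
    qed
  qed
qed

text \<open>A devil's staircase with infinitely many steps: it is constant except on the rightmost gaps,
  the gap from \<open>1 - 2 / 3 ^ (n + 1)\<close> to \<open>1 - 1 / 3 ^ (n + 1)\<close> being stretched linearly onto the interval from \<open>n / (n + 1)\<close> to
  \<open>(n + 1) / (n + 2)\<close>, on which \<open>ell_inf\<close> traverses circle \<open>n + 1\<close>. The clamped linear function in
  the \<open>n\<close>-th term grows from 0 to 1 on exactly this gap.\<close>

definition stair :: "real \<Rightarrow> real" where
  "stair t = (\<Sum>n. 1 / ((real n + 1) * (real n + 2)) * min 1 (max 0 (3 ^ Suc n * (t - 1) + 2)))"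

lemma telescoping_sum: "(\<Sum>k<n. 1 / ((real k + 1) * (real k + 2))) = real n / (real n + 1)"
proof (induction n)
  case (Suc n)
  have "real n / (real n + 1) + 1 / ((real n + 1) * (real n + 2)) = (real n + 1) / (real n + 2)"
    by (simp add: divide_simps) (simp add: algebra_simps)
  then show ?case using Suc by (simp add: add.commute)
qed simp

lemma telescoping_sums: "(\<lambda>n. 1 / ((real n + 1) * (real n + 2))) sums 1"
  unfolding sums_def telescoping_sum by real_asymp

lemma stair_term_bounds:
  fixes t :: real
  defines "f \<equiv> \<lambda>n. 1 / ((real n + 1) * (real n + 2)) * min 1 (max 0 (3 ^ Suc n * (t - 1) + 2))"
  shows "0 \<le> f n" "f n \<le> 1 / ((real n + 1) * (real n + 2))"
proof -
  have "1 / ((real n + 1) * (real n + 2)) * min 1 (max 0 (3 ^ Suc n * (t - 1) + 2)) \<le> 1 / ((real n + 1) * (real n + 2)) * 1"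
    by (rule mult_left_mono) simp_all
  then show "f n \<le> 1 / ((real n + 1) * (real n + 2))" unfolding f_def by simp
  show "0 \<le> f n" unfolding f_def by (intro mult_nonneg_nonneg) simp_all
qed

lemma continuous_on_stair: "continuous_on {0..1} stair"
proof -
  let ?f = "\<lambda>n t::real. 1 / ((real n + 1) * (real n + 2)) * min 1 (max 0 (3 ^ Suc n * (t - 1) + 2))"
  have "uniform_limit {0..1} (\<lambda>n t. \<Sum>i<n. ?f i t) (\<lambda>t. suminf (\<lambda>i. ?f i t)) sequentially"
  proof (rule Weierstrass_m_test)
    show "norm (?f n t) \<le> 1 / ((real n + 1) * (real n + 2))" for n t
      unfolding real_norm_def using stair_term_bounds[of n t] by (simp only: abs_of_nonneg)
    show "summable (\<lambda>n. 1 / ((real n + 1) * (real n + 2)))"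
      using telescoping_sums by (rule sums_summable)
  qed
  then have "continuous_on {0..1} (\<lambda>t. suminf (\<lambda>i. ?f i t))"
    by (rule uniform_limit_theorem[rotated]) (auto intro!: always_eventually continuous_intros)
  then show ?thesis by (simp add: stair_def[abs_def])
qed

lemma stair_in_unit: "stair t \<in> {0..1}"
proof -
  let ?f = "\<lambda>n. 1 / ((real n + 1) * (real n + 2)) * min 1 (max 0 (3 ^ Suc n * (t - 1) + 2))"
  have c: "summable (\<lambda>n. 1 / ((real n + 1) * (real n + 2)))" using telescoping_sums by (rule sums_summable)
  have f: "summable ?f"
    by (rule summable_comparison_test'[OF c, of 0])
      (unfold real_norm_def, use stair_term_bounds[of _ t] in \<open>simp only: abs_of_nonneg\<close>)
  have "stair t \<le> (\<Sum>n. 1 / ((real n + 1) * (real n + 2)))"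
    unfolding stair_def using stair_term_bounds(2) f c by (rule suminf_le)
  also have "\<dots> = 1" using telescoping_sums by (rule sums_unique[symmetric])
  finally have "stair t \<le> 1" .
  moreover have "0 \<le> stair t" unfolding stair_def using f stair_term_bounds(1) by (rule suminf_nonneg)
  ultimately show ?thesis by simp
qed

lemma stair_eq:
  assumes "1 - 1 / 3 ^ n \<le> t" "t \<le> 1 - 1 / 3 ^ Suc n"
  shows "stair t = real n / (real n + 1) + 1 / ((real n + 1) * (real n + 2)) * max 0 (3 ^ Suc n * (t - 1) + 2)"
proof -
  let ?c = "\<lambda>n. 1 / ((real n + 1) * (real n + 2))"
  let ?f = "\<lambda>n. ?c n * min 1 (max 0 (3 ^ Suc n * (t - 1) + 2))"
  have above: "?f m = 0" if "m \<notin> {..n}" for m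
  proof -
    have "(3::real) ^ Suc (Suc n) \<le> 3 ^ Suc m" using that by (intro power_increasing) auto
    then have "3 ^ Suc m * (1 / 3 ^ Suc n) \<ge> 3 ^ Suc (Suc n) * (1 / (3::real) ^ Suc n)"
      by (rule mult_right_mono) simp
    then have "3 \<le> 3 ^ Suc m * (1 / (3::real) ^ Suc n)" by simp
    moreover have "3 ^ Suc m * (1 - t) \<ge> 3 ^ Suc m * (1 / 3 ^ Suc n)" using assms by (intro mult_left_mono) auto
    ultimately have "3 ^ Suc m * (t - 1) + 2 \<le> 0" by (simp add: algebra_simps)
    then show ?thesis by (simp add: max_def)
  qed
  have below: "?f m = ?c m" if "m < n" for m
  proof -
    have "(3::real) ^ Suc m * (1 / 3 ^ n) \<le> 3 ^ n * (1 / 3 ^ n)"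
      using that by (intro mult_right_mono power_increasing) auto
    then have "(3::real) ^ Suc m * (1 / 3 ^ n) \<le> 1" by simp
    moreover have "3 ^ Suc m * (1 - t) \<le> 3 ^ Suc m * (1 / 3 ^ n)" using assms by (intro mult_left_mono) auto
    moreover have "3 ^ Suc m * (t - 1) = - (3 ^ Suc m * (1 - t))" by (simp add: algebra_simps)
    ultimately have "1 \<le> 3 ^ Suc m * (t - 1) + 2" by linarith
    then have "min 1 (max 0 (3 ^ Suc m * (t - 1) + 2)) = 1" by simp
    then show ?thesis by (simp only: mult_1_right)
  qed
  have "3 ^ Suc n * (1 - t) \<ge> 3 ^ Suc n * (1 / 3 ^ Suc n)" using assms(2) by (intro mult_left_mono) auto
  then have "max 0 (3 ^ Suc n * (t - 1) + 2) \<le> 1" by (simp add: algebra_simps)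
  then have n: "?f n = ?c n * max 0 (3 ^ Suc n * (t - 1) + 2)" by (simp only: min.absorb2)
  have "stair t = (\<Sum>m\<le>n. ?f m)" unfolding stair_def by (rule suminf_finite) (use above in auto)
  also have "\<dots> = (\<Sum>m<n. ?f m) + ?f n" by (simp only: lessThan_Suc_atMost[symmetric] sum.lessThan_Suc)
  also have "(\<Sum>m<n. ?f m) = (\<Sum>m<n. ?c m)" by (rule sum.cong) (use below in auto)
  finally show ?thesis unfolding n telescoping_sum .
qed

lemma stair_ends: "stair 0 = 0" "stair 1 = 1"
proof -
  show "stair 0 = 0" using stair_eq[of 0 0] by simp
  have "stair 1 = (\<Sum>n. 1 / ((real n + 1) * (real n + 2)))" by (simp add: stair_def)
  then show "stair 1 = 1" using telescoping_sums by (simp add: sums_iff)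
qed

text \<open>After thinning, \<open>ell_tau\<close> traverses the circles in the same order as \<open>ell_inf\<close> and pauses in
  between; \<open>stair\<close> absorbs the pauses.\<close>

lemma ell_inf_as_image_of_ell_tau:
  obtains h where "continuous_on earring h" "h \<in> earring \<rightarrow> earring" "h b0 = b0"
    "\<And>m t. 1 \<le> m \<Longrightarrow> t \<in> {0..1} \<Longrightarrow> h (ell m t) = thinned m t"
    "homotopic_paths earring ell_inf (h \<circ> ell_tau)"
proof -
  obtain h where h: "continuous_on earring h" "h \<in> earring \<rightarrow> earring" "h b0 = b0"
    "\<And>m t. 1 \<le> m \<Longrightarrow> t \<in> {0..1} \<Longrightarrow> h (ell m t) = thinned m t"
    by (rule earring_self_map_exists[OF thinned_loop thinned_null]) blast+
  obtain a b where G: "gap_family a b"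
    and tau: "\<And>t. t \<in> {0..1} \<Longrightarrow> ell_tau t = gap_family.concat_over a b ell b0 t"
    and a: "\<And>m. a (2 ^ Suc m - 1) = 1 - 2 / 3 ^ Suc m" and b: "\<And>m. b (2 ^ Suc m - 1) = 1 - 1 / 3 ^ Suc m"
    by (rule ell_tau_gaps) (rule that)
  interpret G: gap_family a b by (rule G)
  have h_tau: "h (ell_tau t) = G.concat_over thinned b0 t" if "t \<in> {0..1}" for t
    unfolding tau[OF that] by (rule G.compose_concat_over[where F = h, OF h(4) h(3)])
  have ab: "harm_a (Suc n) = real n / (real n + 1)" "harm_b (Suc n) - harm_a (Suc n) = 1 / ((real n + 1) * (real n + 2))" for n
    by (simp_all add: harm_a_def harm_b_def divide_simps) (simp_all add: algebra_simps)
  have ell_inf_stair: "ell_inf (stair t) = ell (Suc n) (max 0 (3 ^ Suc n * (t - 1) + 2))"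
    if t: "1 - 1 / 3 ^ n \<le> t" "t \<le> 1 - 1 / 3 ^ Suc n" for n t
  proof -
    define w where "w = max 0 (3 ^ Suc n * (t - 1) + 2)"
    have "3 ^ Suc n * (1 - t) \<ge> 3 ^ Suc n * (1 / 3 ^ Suc n)" using t(2) by (intro mult_left_mono) auto
    then have w: "0 \<le> w" "w \<le> 1" by (auto simp: w_def algebra_simps)
    have st: "stair t = harm_a (Suc n) + (harm_b (Suc n) - harm_a (Suc n)) * w"
      unfolding ab(2) unfolding ab(1) stair_eq[OF t] w_def ..
    have d: "harm_a (Suc n) < harm_b (Suc n)" by (rule harm.a_less_b) simp
    have "0 \<le> (harm_b (Suc n) - harm_a (Suc n)) * w" "(harm_b (Suc n) - harm_a (Suc n)) * w \<le> harm_b (Suc n) - harm_a (Suc n)"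
      using d w by (auto intro: mult_left_le)
    then have le: "harm_a (Suc n) \<le> stair t" "stair t \<le> harm_b (Suc n)" unfolding st by linarith+
    then have "stair t \<in> {0..1}" using harm.a_nonneg[of "Suc n"] harm.b_le_1[of "Suc n"] by simp
    then have "ell_inf (stair t) = ell (Suc n) ((stair t - harm_a (Suc n)) / (harm_b (Suc n) - harm_a (Suc n)))"
      by (simp add: ell_inf_eq harm.concat_over_closed[of "Suc n", OF _ le])
    also have "(stair t - harm_a (Suc n)) / (harm_b (Suc n) - harm_a (Suc n)) = w" using d by (simp add: st)
    finally show ?thesis unfolding w_def .
  qed
  have reparam: "h (ell_tau t) = ell_inf (stair t)" if t: "t \<in> {0..1}" for t
  proof (cases "\<exists>n. a (2 ^ Suc n - 1) < t \<and> t < b (2 ^ Suc n - 1)")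
    case True
    then obtain n where n: "a (2 ^ Suc n - 1) < t" "t < b (2 ^ Suc n - 1)" by blast
    have "(1::nat) < 2 ^ Suc n" by (rule one_less_power) auto
    then have N1: "1 \<le> (2::nat) ^ Suc n - 1" by linarith
    have Suc_n: "1 \<le> Suc n" by simp
    have le: "1 - 1 / 3 ^ n \<le> t" "t \<le> 1 - 1 / 3 ^ Suc n" and pos: "1 - 2 / 3 ^ Suc n < t"
      using n unfolding a b by (auto simp: field_simps)
    have "3 ^ Suc n * (1 - t) < 3 ^ Suc n * (2 / 3 ^ Suc n)" using pos by (intro mult_strict_left_mono) auto
    then have "0 \<le> 3 ^ Suc n * (t - 1) + 2" by (simp add: algebra_simps)
    moreover have "(t - a (2 ^ Suc n - 1)) / (b (2 ^ Suc n - 1) - a (2 ^ Suc n - 1)) = 3 ^ Suc n * (t - 1) + 2"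
      unfolding a b by (simp add: field_simps)
    ultimately show ?thesis
      unfolding h_tau[OF t] G.concat_over_open[OF N1 n] ell_inf_stair[OF le] thinned_mersenne[OF Suc_n]
      by (simp only: max_absorb2)
  next
    case False
    have "h (ell_tau t) = b0"
    proof (cases "\<exists>m\<ge>1. a m < t \<and> t < b m")
      case True
      then obtain m where m: "1 \<le> m" "a m < t" "t < b m" by blast
      show ?thesis
      proof (cases rule: thinned_cases[of m])
        case (1 k)
        then obtain k' where "m = 2 ^ Suc k' - 1" by (cases k) auto
        then show ?thesis using False m by blast
      next
        case 2
        then show ?thesis unfolding h_tau[OF t] G.concat_over_open[OF m] by simp
      qed
    next
      case False
      then show ?thesis unfolding h_tau[OF t] by (simp add: G.concat_over_outside)
    qed
    moreover have "ell_inf (stair t) = b0"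
    proof (cases "t = 1")
      case True
      then show ?thesis by (simp add: stair_ends ell_inf_def)
    next
      case False
      obtain N where "(1 / 3) ^ N < 1 - t" using real_arch_pow_inv[of "1 - t" "1/3"] False t by auto
      then have ex: "\<exists>n. t < 1 - 1 / 3 ^ n" by (intro exI[of _ N]) (simp add: power_one_over)
      define n where "n = (LEAST n. t < 1 - 1 / 3 ^ n)"
      have n: "t < 1 - 1 / 3 ^ n" unfolding n_def using ex by (rule LeastI_ex)
      then obtain k where k: "n = Suc k" using t by (cases n) auto
      have le: "1 - 1 / 3 ^ k \<le> t" using not_less_Least[of k "\<lambda>n. t < 1 - 1 / 3 ^ n"] k unfolding n_def by simp
      have "t \<le> 1 - 2 / 3 ^ Suc k"
        using \<open>\<not> (\<exists>n. a (2 ^ Suc n - 1) < t \<and> t < b (2 ^ Suc n - 1))\<close> n unfolding a b k by (meson not_le)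
      then have "3 ^ Suc k * (2 / 3 ^ Suc k) \<le> 3 ^ Suc k * (1 - t)" by (intro mult_left_mono) auto
      then have "max 0 (3 ^ Suc k * (t - 1) + 2) = 0" by (simp add: algebra_simps)
      moreover have "t \<le> 1 - 1 / 3 ^ Suc k" using n k by simp
      ultimately show ?thesis using ell_inf_stair[OF le] by (simp del: power_Suc)
    qed
    ultimately show ?thesis by simp
  qed
  have "homotopic_paths earring ell_inf (h \<circ> ell_tau)"
    by (rule homotopic_paths_reparametrize[where f = stair])
      (use ell_inf_loop continuous_on_stair stair_ends stair_in_unit reparam in \<open>auto simp: loops_at_def\<close>)
  then show thesis using that h by blast
qed

lemma Cinf_closed_if_Ctau_closed:
  assumes H: "Ctau_closed X x0 H"
  shows "Cinf_closed X x0 H"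
  unfolding c_inf_def test_closed_iff[OF ell_inf_loop]
proof (intro conjI allI impI)
  show sub: "subgroup H (pi1 X x0)" using H by (simp add: test_closed_def)
  fix \<sigma> g
  assume \<sigma>: "\<sigma> \<in> paths_in X x0 (g b0)" and g: "continuous_on earring g" "g \<in> earring \<rightarrow> X"
    and gens: "\<forall>n\<ge>1. conj_class X \<sigma> (g \<circ> ell n) \<in> H"
  obtain h where h: "continuous_on earring h" "h \<in> earring \<rightarrow> earring" "h b0 = b0"
    "\<And>m t. 1 \<le> m \<Longrightarrow> t \<in> {0..1} \<Longrightarrow> h (ell m t) = thinned m t"
    and hom: "homotopic_paths earring ell_inf (h \<circ> ell_tau)"
    by (rule ell_inf_as_image_of_ell_tau) blast
  have "conj_class X \<sigma> ((g \<circ> h) \<circ> ell m) \<in> H" if m: "1 \<le> m" for m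
  proof -
    have "conj_class X \<sigma> ((g \<circ> h) \<circ> ell m) = conj_class X \<sigma> (g \<circ> thinned m)"
      by (rule conj_class_ext) (use h(4)[OF m] in auto)
    also have "\<dots> \<in> H"
    proof (cases rule: thinned_cases[of m])
      case (1 n)
      then show ?thesis using gens by simp
    next
      case 2
      then show ?thesis using conj_class_const[OF \<sigma>] subgroup.one_closed[OF sub] by (simp add: o_def)
    qed
    finally show ?thesis .
  qed
  moreover have "continuous_on earring (g \<circ> h)"
    using h g by (intro continuous_on_compose) (auto intro: continuous_on_subset)
  moreover have "g \<circ> h \<in> earring \<rightarrow> X" using g h by auto
  moreover have "\<sigma> \<in> paths_in X x0 ((g \<circ> h) b0)" using \<sigma> h by simp
  ultimately have "conj_class X \<sigma> ((g \<circ> h) \<circ> ell_tau) \<in> H"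
    using H unfolding c_tau_def test_closed_iff[OF ell_tau_loop] by blast
  moreover have "conj_class X \<sigma> (g \<circ> ell_inf) = conj_class X \<sigma> (g \<circ> (h \<circ> ell_tau))"
    by (rule conj_class_cong[OF \<sigma> homotopic_paths_continuous_image[OF hom g] loops_at_compose_earring[OF ell_inf_loop g]])
  ultimately show "conj_class X \<sigma> (g \<circ> ell_inf) \<in> H" by (simp add: comp_assoc)
qed

section \<open>The Cantor loop as a telescoping infinite product\<close>

text \<open>The infinite product of the \<open>\<beta> n \<cdot> (\<beta> (n + 1))\<^sup>-\<close> is parametrized over the gaps from \<open>harm_a n\<close> to \<open>harm_b n\<close>,
  each factor switching from \<open>\<beta> n\<close> to the reverse of \<open>\<beta> (n + 1)\<close> at the midpoint. To cancel, the product is cut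
  at the midpoints instead: the first piece is \<open>\<beta> 1\<close>, the later ones run through the reverse of \<open>\<beta> n\<close> and
  then through \<open>\<beta> n\<close>.\<close>

definition mid :: "nat \<Rightarrow> real" where "mid n = (harm_a n + harm_b n) / 2"

definition mid_a :: "nat \<Rightarrow> real" where "mid_a n = (if n \<le> 1 then 0 else mid (n - 1))"

definition harm_coord :: "nat \<Rightarrow> real \<Rightarrow> real" where
  "harm_coord n t = (t - harm_a n) / (harm_b n - harm_a n)"

lemma mid_between: "1 \<le> n \<Longrightarrow> harm_a n < mid n \<and> mid n < harm_b n"
  using harm.a_less_b[of n] by (simp add: mid_def)

lemma mid_pred_less:
  assumes "2 \<le> n"
  shows "mid (n - 1) < harm_a n"
proof -
  have "1 \<le> n - 1" "Suc (n - 1) = n" using assms by auto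
  then show ?thesis using mid_between[of "n - 1"] harm_b_eq[of "n - 1"] by simp
qed

lemma mid_mono:
  assumes "1 \<le> m" "m \<le> n"
  shows "mid m \<le> mid n"
  using assms(2,1)
proof (induction n rule: dec_induct)
  case (step n)
  then show ?case using mid_between[of n] mid_between[of "Suc n"] by (simp add: harm_b_eq)
qed simp

lemma mid_1: "mid 1 = 1 / 4"
  by (simp add: mid_def harm_a_def harm_b_def)

interpretation midpts: gap_family mid_a mid
proof
  show "0 \<le> mid_a n" for n
  proof (cases "n \<le> 1")
    case False
    then have "1 \<le> n - 1" by simp
    from mid_between[OF this] harm.a_nonneg[OF this] show ?thesis using False by (simp add: mid_a_def)
  qed (simp add: mid_a_def)
  show "mid_a n < mid n" if "1 \<le> n" for n
  proof (cases "n = 1")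
    case False
    then have "2 \<le> n" using that by simp
    from mid_pred_less[OF this] show ?thesis using mid_between[OF that] False that by (simp add: mid_a_def)
  qed (use mid_1 in \<open>simp add: mid_a_def\<close>)
  show "mid n \<le> 1" if "1 \<le> n" for n
    using mid_between[OF that] harm.b_le_1[OF that] by linarith
  have lt: "mid m \<le> mid_a n" if "1 \<le> m" "m < n" for m n
    using that mid_mono[of m "n - 1"] by (simp add: mid_a_def)
  show "m = n" if "1 \<le> m" "1 \<le> n" "mid_a m < t" "t < mid m" "mid_a n < t" "t < mid n" for m n t
    using lt[of m n] lt[of n m] that by (cases m n rule: linorder_cases) auto
qed

lemma harm_coord_le_half: "1 \<le> n \<Longrightarrow> t \<le> mid n \<longleftrightarrow> 2 * harm_coord n t \<le> 1"
  using harm.a_less_b[of n] by (simp add: harm_coord_def mid_def field_simps)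

lemma harm_coord_nonpos: "1 \<le> n \<Longrightarrow> harm_coord n t \<le> 0 \<longleftrightarrow> t \<le> harm_a n"
  using harm.a_less_b[of n] by (simp add: harm_coord_def field_simps)

lemma harm_coord_ge_1: "1 \<le> n \<Longrightarrow> 1 \<le> harm_coord n t \<longleftrightarrow> harm_b n \<le> t"
  using harm.a_less_b[of n] by (simp add: harm_coord_def field_simps)

lemma harm_coord_mid: "1 \<le> n \<Longrightarrow> harm_coord n (mid n) = 1 / 2"
  using harm.a_less_b[of n] by (simp add: harm_coord_def mid_def field_simps)

text \<open>Between consecutive midpoints the product follows \<open>\<beta> n\<close> along a V-shaped function of time that goes down from 1
  to 0 and up again. Cutting this function off from below at height \<open>s\<close>, and letting \<open>s\<close> grow to 1,
  contracts the piece to the base point within the image of \<open>\<beta> n\<close>. These contractions shrink as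
  \<open>n\<close> grows, so they can be performed all at once, and only \<open>\<beta> 1\<close> followed by a pause remains.\<close>

lemma telescoping_product:
  fixes \<beta> :: "nat \<Rightarrow> real \<Rightarrow> 'b::topological_space"
  assumes loops: "\<And>n. 1 \<le> n \<Longrightarrow> \<beta> n \<in> loops_at T y" and y: "y \<in> T"
    and null: "\<And>U. open U \<Longrightarrow> y \<in> U \<Longrightarrow> finite {n. 1 \<le> n \<and> \<not> path_image (\<beta> n) \<subseteq> U}"
  shows "homotopic_paths T (harm.concat_over (\<lambda>n. \<beta> n +++ reversepath (\<beta> (Suc n))) y) (\<beta> 1)"
proof -
  \<comment> \<open>The V-shaped function; of its two linear branches the irrelevant one is nonpositive.\<close>
  define V where "V n t = max (2 - 2 * harm_coord (n - 1) t) (2 * harm_coord n t)" for n t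
  define pos where "pos n w = mid_a n + w * (mid n - mid_a n)" for n w
  \<comment> \<open>The homotopies are expressed in the normalized coordinate \<open>w\<close> of the interval between two midpoints.\<close>
  define h where "h n s w = (if n = 1 then \<beta> 1 w else \<beta> n (max s (V n (pos n w))))" for n and s w :: real
  have \<beta>: "path (\<beta> n)" "path_image (\<beta> n) \<subseteq> T" "\<beta> n 0 = y" "\<beta> n 1 = y" if "1 \<le> n" for n
    using loops[OF that] by (auto simp: loops_at_def pathstart_def pathfinish_def)
  have pos: "mid_a n \<le> pos n w \<and> pos n w \<le> mid n" if "1 \<le> n" "w \<in> {0..1}" for n w
  proof -
    have "0 \<le> w * (mid n - mid_a n)" "w * (mid n - mid_a n) \<le> mid n - mid_a n"
      using that midpts.a_less_b[of n] by (auto intro: mult_left_le_one_le)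
    then show ?thesis unfolding pos_def by linarith
  qed
  have V_le: "V n t \<le> 1" if "2 \<le> n" "mid_a n \<le> t" "t \<le> mid n" for n t
  proof -
    have "2 * harm_coord n t \<le> 1" using that harm_coord_le_half[of n t] by simp
    moreover have "1 \<le> 2 * harm_coord (n - 1) t"
    proof (cases "t = mid (n - 1)")
      case True
      have "1 \<le> n - 1" using that by simp
      from harm_coord_mid[OF this] show ?thesis unfolding True by simp
    next
      case False
      have "1 \<le> n - 1" using that by simp
      from harm_coord_le_half[OF this, of t] show ?thesis using False that by (simp add: mid_a_def)
    qed
    ultimately show ?thesis by (simp add: V_def)
  qed
  have arg: "max s (V n (pos n w)) \<in> {0..1}" if "2 \<le> n" "s \<in> {0..1}" "w \<in> {0..1}" for n s w
    using V_le[of n "pos n w"] pos[of n w] that by auto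
  have h_in: "h n s w \<in> path_image (\<beta> n)" if "1 \<le> n" "s \<in> {0..1}" "w \<in> {0..1}" for n s w
    using that arg[of n s w] by (auto simp: h_def path_image_def)
  have main: "homotopic_paths T (midpts.concat_over (\<lambda>n. h n 0) y) (midpts.concat_over (\<lambda>n. h n 1) y)"
  proof (rule midpts.homotopic_paths_concat_over)
    show "continuous_on ({0..1} \<times> {0..1}) (\<lambda>z. h n (fst z) (snd z))" if n: "1 \<le> n" for n
    proof (cases "n = 1")
      case True
      have "continuous_on ({0..1} \<times> {0..1}) (\<lambda>z::real \<times> real. \<beta> 1 (snd z))"
        by (rule continuous_on_compose2[of "{0..1}" "\<beta> 1"]) (use \<beta>(1)[of 1] in \<open>auto simp: path_def intro: continuous_intros\<close>)
      then show ?thesis using True by (simp add: h_def)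
    next
      case False
      have "continuous_on ({0..1} \<times> {0..1}) (\<lambda>z. \<beta> n (max (fst z) (V n (pos n (snd z)))))"
      proof (rule continuous_on_compose2[of "{0..1}" "\<beta> n"])
        show "continuous_on {0..1} (\<beta> n)" using \<beta>(1)[OF n] by (simp add: path_def)
        show "continuous_on ({0..1} \<times> {0..1}) (\<lambda>z. max (fst z) (V n (pos n (snd z))))"
          unfolding V_def pos_def harm_coord_def divide_inverse by (intro continuous_intros)
        show "(\<lambda>z. max (fst z) (V n (pos n (snd z)))) ` ({0..1} \<times> {0..1}) \<subseteq> {0..1}"
          using False n arg[of n] by auto
      qed
      then show ?thesis using False by (simp add: h_def)
    qed
    show "h n s 0 = y" if n: "1 \<le> n" and s: "s \<in> {0..1}" for n s
    proof (cases "n = 1")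
      case False
      have p: "pos n 0 = mid (n - 1)" using False n by (simp add: pos_def mid_a_def)
      have "harm_coord (n - 1) (pos n 0) = 1 / 2"
        unfolding p using False n by (intro harm_coord_mid) simp
      then have "1 \<le> V n (pos n 0)" by (simp add: V_def)
      then have "max s (V n (pos n 0)) = 1" using arg[of n s 0] False n s by auto
      then show ?thesis using False \<beta>(4)[OF n] by (simp add: h_def)
    qed (use \<beta> in \<open>simp add: h_def\<close>)
    show "h n s 1 = y" if n: "1 \<le> n" and s: "s \<in> {0..1}" for n s
    proof (cases "n = 1")
      case False
      have "harm_coord n (pos n 1) = 1 / 2" using harm_coord_mid[OF n] by (simp add: pos_def)
      then have "1 \<le> V n (pos n 1)" by (simp add: V_def)
      then have "max s (V n (pos n 1)) = 1" using arg[of n s 1] False n s by auto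
      then show ?thesis using False \<beta>(4)[OF n] by (simp add: h_def)
    qed (use \<beta> in \<open>simp add: h_def\<close>)
    show "finite {n. 1 \<le> n \<and> \<not> (\<forall>s\<in>{0..1}. h n s ` {0..1} \<subseteq> U)}" if "open U" "y \<in> U" for U
      by (rule finite_subset[OF _ null[OF that]]) (use h_in in blast)
    show "h n s ` {0..1} \<subseteq> T" if "1 \<le> n" "s \<in> {0..1}" for n s
      using h_in[OF that] \<beta>(2)[OF that(1)] by blast
  qed (rule y)
  have pos_inv: "pos n ((t - mid_a n) / (mid n - mid_a n)) = t" if "1 \<le> n" for n t
    using midpts.a_less_b[OF that] by (simp add: pos_def)
  have mid_value: "midpts.concat_over (\<lambda>n. h n s) y t = h n s ((t - mid_a n) / (mid n - mid_a n))"
    if "1 \<le> n" "mid_a n \<le> t" "t \<le> mid n" "s \<in> {0..1}" for n s t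
  proof -
    have "h n s 0 = y \<and> h n s 1 = y"
    proof (cases "n = 1")
      case True
      then show ?thesis using \<beta>[of 1] by (simp add: h_def)
    next
      case False
      have "harm_coord (n - 1) (pos n 0) = 1 / 2" "harm_coord n (pos n 1) = 1 / 2"
        using harm_coord_mid[of n] harm_coord_mid[of "n - 1"] that False by (simp_all add: pos_def mid_a_def)
      then have "1 \<le> V n (pos n 0)" "1 \<le> V n (pos n 1)" by (simp_all add: V_def)
      then have "max s (V n (pos n 0)) = 1" "max s (V n (pos n 1)) = 1"
        using arg[of n s 0] arg[of n s 1] False that by auto
      then show ?thesis using False \<beta>(4)[OF that(1)] by (simp add: h_def)
    qed
    then show ?thesis using that by (intro midpts.concat_over_closed) auto
  qed
  have start: "midpts.concat_over (\<lambda>n. h n 0) y t = harm.concat_over (\<lambda>n. \<beta> n +++ reversepath (\<beta> (Suc n))) y t"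
    if t: "t \<in> {0..1}" for t
  proof (cases "t = 1")
    case True
    then show ?thesis by (simp add: midpts.concat_over_ends harm.concat_over_ends)
  next
    case False
    then obtain n where n: "1 \<le> n" "harm_a n \<le> t" "t < harm_b n" using harm_cover[of t] t by auto
    have R: "harm.concat_over (\<lambda>n. \<beta> n +++ reversepath (\<beta> (Suc n))) y t = (\<beta> n +++ reversepath (\<beta> (Suc n))) (harm_coord n t)"
      unfolding harm_coord_def using n \<beta>(3)[OF n(1)] \<beta>(3)[of "Suc n"]
      by (intro harm.concat_over_closed) (auto simp: joinpaths_def reversepath_def)
    have u: "0 \<le> harm_coord n t" using harm.a_less_b[OF n(1)] n(2) by (simp add: harm_coord_def)
    have u1: "harm_coord n t \<le> 1" using harm_coord_ge_1[OF n(1), of t] n(3) by linarith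
    show ?thesis
    proof (cases "t \<le> mid n")
      case True
      then have half: "harm_coord n t \<le> 1 / 2" using harm_coord_le_half[OF n(1)] by simp
      have ma: "mid_a n \<le> t"
      proof (cases "n = 1")
        case False
        then have "2 \<le> n" using n by simp
        from mid_pred_less[OF this] show ?thesis using n False by (simp add: mid_a_def)
      qed (use t in \<open>simp add: mid_a_def\<close>)
      have L: "midpts.concat_over (\<lambda>n. h n 0) y t = h n 0 ((t - mid_a n) / (mid n - mid_a n))"
        by (rule mid_value) (use n ma True in auto)
      show ?thesis
      proof (cases "n = 1")
        case True
        have "(t - mid_a 1) / (mid 1 - mid_a 1) = 2 * harm_coord 1 t"
          by (simp add: mid_a_def mid_def harm_a_def harm_b_def harm_coord_def)
        then show ?thesis unfolding L R using True half by (simp add: h_def joinpaths_def)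
      next
        case False
        have "1 \<le> harm_coord (n - 1) t"
          using harm_coord_ge_1[of "n - 1" t] harm_b_eq[of "n - 1"] n False by simp
        then have "max 0 (V n t) = 2 * harm_coord n t" using u by (simp add: V_def)
        then show ?thesis unfolding L R using False half by (simp add: h_def joinpaths_def pos_inv[OF n(1)])
      qed
    next
      case False
      then have half: "\<not> harm_coord n t \<le> 1 / 2" using harm_coord_le_half[OF n(1)] by simp
      have le: "t \<le> mid (Suc n)" using n(3) mid_between[of "Suc n"] harm_b_eq[of n] by simp
      have L: "midpts.concat_over (\<lambda>n. h n 0) y t = h (Suc n) 0 ((t - mid_a (Suc n)) / (mid (Suc n) - mid_a (Suc n)))"
        by (rule mid_value) (use n le False in \<open>auto simp: mid_a_def\<close>)
      have "harm_coord (Suc n) t \<le> 0"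
        using harm_coord_nonpos[of "Suc n" t] harm_b_eq[of n] n by simp
      then have "max 0 (V (Suc n) t) = 2 - 2 * harm_coord n t" using u1 by (simp add: V_def)
      then show ?thesis unfolding L R using half n(1)
        by (simp add: h_def joinpaths_def reversepath_def pos_inv)
    qed
  qed
  have finish: "midpts.concat_over (\<lambda>n. h n 1) y t = \<beta> 1 (min (4 * t) 1)" if t: "t \<in> {0..1}" for t
  proof (cases "t \<le> 1 / 4")
    case True
    have "midpts.concat_over (\<lambda>n. h n 1) y t = h 1 1 ((t - mid_a 1) / (mid 1 - mid_a 1))"
      by (rule mid_value) (use True t mid_1 in \<open>auto simp: mid_a_def\<close>)
    also have "(t - mid_a 1) / (mid 1 - mid_a 1) = 4 * t" unfolding mid_1 by (simp add: mid_a_def)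
    also have "h 1 1 (4 * t) = \<beta> 1 (min (4 * t) 1)" using True by (simp add: h_def)
    finally show ?thesis .
  next
    case False
    have "midpts.concat_over (\<lambda>n. h n 1) y t = y"
    proof (cases "\<exists>n\<ge>1. mid_a n < t \<and> t < mid n")
      case True
      then obtain n where n: "1 \<le> n" "mid_a n < t" "t < mid n" by blast
      then have "n \<noteq> 1" using False mid_1 by auto
      have "midpts.concat_over (\<lambda>n. h n 1) y t = h n 1 ((t - mid_a n) / (mid n - mid_a n))"
        by (rule midpts.concat_over_open[OF n])
      moreover have "max 1 (V n t) = 1" using V_le[of n t] n \<open>n \<noteq> 1\<close> by simp
      ultimately show ?thesis using \<open>n \<noteq> 1\<close> \<beta>(4)[OF n(1)] by (simp add: h_def pos_inv[OF n(1)])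
    next
      case False
      then show ?thesis by (intro midpts.concat_over_outside) blast
    qed
    then show ?thesis using False \<beta>(4)[of 1] by simp
  qed
  have P: "path (midpts.concat_over (\<lambda>n. h n 0) y)" "path_image (midpts.concat_over (\<lambda>n. h n 0) y) \<subseteq> T"
    using homotopic_paths_imp_path[OF main] homotopic_paths_imp_subset[OF main] by auto
  have "homotopic_paths T (harm.concat_over (\<lambda>n. \<beta> n +++ reversepath (\<beta> (Suc n))) y) (midpts.concat_over (\<lambda>n. h n 0) y)"
    by (rule homotopic_paths_sym, rule homotopic_paths_eq[OF P]) (rule start)
  also note main
  also have "homotopic_paths T (midpts.concat_over (\<lambda>n. h n 1) y) (\<beta> 1)"
  proof (rule homotopic_paths_sym, rule homotopic_paths_reparametrize[where f = "\<lambda>t. min (4 * t) 1"])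
    show "continuous_on {0..1} (\<lambda>t::real. min (4 * t) 1)" by (intro continuous_intros)
  qed (use \<beta>[of 1] finish in auto)
  finally show ?thesis .
qed

lemma subpath_loop:
  assumes "p \<in> loops_at earring b0" "u \<in> {0..1}" "v \<in> {0..1}" "p u = b0" "p v = b0"
  shows "subpath u v p \<in> loops_at earring b0"
  using assms path_image_subpath_subset[of u v p] by (auto simp: loops_at_def)

context
  fixes X :: "'a::topological_space set" and x0 :: 'a and \<sigma> :: "real \<Rightarrow> 'a" and g :: "real \<times> real \<Rightarrow> 'a"
  assumes \<sigma>: "\<sigma> \<in> paths_in X x0 (g b0)" and g: "continuous_on earring g" "g \<in> earring \<rightarrow> X"
begin

abbreviation push :: "(real \<Rightarrow> real \<times> real) \<Rightarrow> (real \<Rightarrow> 'a) set" where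
  "push p \<equiv> conj_class X \<sigma> (g \<circ> p)"

lemma push_cong: "homotopic_paths earring p q \<Longrightarrow> p \<in> loops_at earring b0 \<Longrightarrow> push p = push q"
  by (rule conj_class_cong[OF \<sigma> homotopic_paths_continuous_image[OF _ g] loops_at_compose_earring[OF _ g]])

lemma push_join:
  "p \<in> loops_at earring b0 \<Longrightarrow> q \<in> loops_at earring b0 \<Longrightarrow> push (p +++ q) = push p \<otimes>\<^bsub>pi1 X x0\<^esub> push q"
  unfolding joinpaths_o by (rule conj_class_join[OF \<sigma> loops_at_compose_earring[OF _ g] loops_at_compose_earring[OF _ g]])

lemma push_reversepath:
  "p \<in> loops_at earring b0 \<Longrightarrow> push (reversepath p) = inv\<^bsub>pi1 X x0\<^esub> push p"
  unfolding o_reversepath by (rule conj_class_reversepath[OF \<sigma> loops_at_compose_earring[OF _ g]])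

lemma push_const: "push (\<lambda>t. b0) = \<one>\<^bsub>pi1 X x0\<^esub>"
  using conj_class_const[OF \<sigma>] by (simp add: o_def)

lemma push_in_carrier: "p \<in> loops_at earring b0 \<Longrightarrow> push p \<in> carrier (pi1 X x0)"
  by (rule conj_class_in_carrier[OF \<sigma> loops_at_compose_earring[OF _ g]])

lemma push_ext: "(\<And>t. t \<in> {0..1} \<Longrightarrow> p t = q t) \<Longrightarrow> push p = push q"
  by (rule conj_class_ext) auto

lemma push_split:
  assumes p: "p \<in> loops_at earring b0" and uv: "0 \<le> u" "u \<le> v" "v \<le> 1" "p u = b0" "p v = b0"
  shows "push p = push (subpath 0 u p) \<otimes>\<^bsub>pi1 X x0\<^esub> (push (subpath u v p) \<otimes>\<^bsub>pi1 X x0\<^esub> push (subpath v 1 p))"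
proof -
  have ends: "p 0 = b0" "p 1 = b0" "path p" "path_image p \<subseteq> earring"
    using p by (auto simp: loops_at_def pathstart_def pathfinish_def)
  have loops: "subpath 0 u p \<in> loops_at earring b0" "subpath u v p \<in> loops_at earring b0"
    "subpath v 1 p \<in> loops_at earring b0" "subpath u 1 p \<in> loops_at earring b0"
    using uv ends p by (auto intro!: subpath_loop)
  have "push (subpath 0 u p +++ subpath u 1 p) = push (subpath 0 1 p)"
    by (rule push_cong[OF homotopic_join_subpaths1]) (use uv ends loops in \<open>auto simp: loops_at_join\<close>)
  moreover have "push (subpath u v p +++ subpath v 1 p) = push (subpath u 1 p)"
    by (rule push_cong[OF homotopic_join_subpaths1]) (use uv ends loops in \<open>auto simp: loops_at_join\<close>)
  ultimately show ?thesis using loops by (simp add: push_join)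
qed

end

text \<open>For the gaps over which \<open>ell_tau\<close> is the concatenation of the circles, these are the loops \<open>\<beta> n\<close> of
  the telescoping product.\<close>

definition (in gap_family) tail_concat :: "nat \<Rightarrow> real \<Rightarrow> real \<times> real" where
  "tail_concat n = concat_over (\<lambda>m. if m < n then (\<lambda>t. b0) else ell m) b0"

context gap_family
begin

lemma tail_concat_loop: "tail_concat n \<in> loops_at earring b0"
  unfolding tail_concat_def
proof (rule concat_over_loop)
  show "(if m < n then \<lambda>t. b0 else ell m) \<in> loops_at earring b0" if "1 \<le> m" for m
    using that by (simp add: ell_loop loops_at_const b0_in_earring)
  show "finite {m. 1 \<le> m \<and> \<not> path_image (if m < n then \<lambda>t. b0 else ell m) \<subseteq> U}" if "open U" "b0 \<in> U" for U
    by (rule finite_subset[OF _ ell_null[OF that]]) (use that in auto)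
qed (rule b0_in_earring)

lemma tail_concat_null:
  assumes "open U" "b0 \<in> U"
  shows "finite {n. 1 \<le> n \<and> \<not> path_image (tail_concat n) \<subseteq> U}"
proof -
  obtain N where N: "{m. 1 \<le> m \<and> \<not> path_image (ell m) \<subseteq> U} \<subseteq> {..<N}"
    using finite_nat_bounded[OF ell_null[OF assms]] by blast
  have "path_image (tail_concat n) \<subseteq> U" if "N \<le> n" for n
  proof -
    have "tail_concat n t \<in> U" for t
      unfolding tail_concat_def
    proof (rule concat_over_in)
      show "(if m < n then \<lambda>t. b0 else ell m) ` {0..1} \<subseteq> U" if "1 \<le> m" for m
      proof (cases "m < n")
        case False
        then have "m \<notin> {m. 1 \<le> m \<and> \<not> path_image (ell m) \<subseteq> U}" using N \<open>N \<le> n\<close> by auto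
        then show ?thesis using False \<open>1 \<le> m\<close> by (simp add: path_image_def)
      qed (use assms in auto)
    qed (rule assms)
    then show ?thesis by (auto simp: path_image_def)
  qed
  then have "{n. 1 \<le> n \<and> \<not> path_image (tail_concat n) \<subseteq> U} \<subseteq> {..<N}" by (auto simp: not_less[symmetric])
  then show ?thesis by (rule finite_subset) simp
qed

text \<open>Outside gap \<open>n\<close> the two tails agree. With \<open>A\<close> and \<open>B\<close> the classes of the parts before and after this
  gap and \<open>M\<close> the class given by \<open>ell n\<close>, the product is \<open>A M B (A B)\<^sup>-\<^sup>1 = A M A\<^sup>-\<^sup>1\<close>.\<close>

lemma tail_concat_step:
  assumes \<sigma>: "\<sigma> \<in> paths_in X x0 (g b0)" and g: "continuous_on earring g" "g \<in> earring \<rightarrow> X"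
    and H: "H \<lhd> pi1 X x0" and n: "1 \<le> n" and gen: "conj_class X \<sigma> (g \<circ> ell n) \<in> H"
  shows "conj_class X \<sigma> (g \<circ> (tail_concat n +++ reversepath (tail_concat (Suc n)))) \<in> H"
proof -
  let ?P = "\<lambda>p. conj_class X \<sigma> (g \<circ> p)"
  note [simp] = tail_concat_loop
  interpret H: normal H "pi1 X x0" by (rule H)
  have ab: "0 \<le> a n" "a n < b n" "b n \<le> 1" using a_nonneg[OF n] a_less_b[OF n] b_le_1[OF n] by auto
  have out: "tail_concat (Suc n) t = tail_concat n t" if "\<not> (a n < t \<and> t < b n)" for t
  proof (cases "\<exists>m\<ge>1. a m < t \<and> t < b m")
    case True
    then obtain m where m: "1 \<le> m" "a m < t" "t < b m" by blast
    then have "m \<noteq> n" using that by blast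
    then show ?thesis unfolding tail_concat_def concat_over_open[OF m] by (simp add: less_Suc_eq)
  next
    case False
    then show ?thesis by (simp add: tail_concat_def concat_over_outside)
  qed
  have inside: "tail_concat k t = (if k \<le> n then ell n ((t - a n) / (b n - a n)) else b0)"
    if "a n \<le> t" "t \<le> b n" for k t
    using that n unfolding tail_concat_def by (subst concat_over_closed[of n]) auto
  have at_ends: "tail_concat k (a n) = b0" "tail_concat k (b n) = b0" for k
    using ab inside[of "a n" k] inside[of "b n" k] by auto
  define A M B where "A = ?P (subpath 0 (a n) (tail_concat n))" and "M = ?P (subpath (a n) (b n) (tail_concat n))"
    and "B = ?P (subpath (b n) 1 (tail_concat n))"
  have carr: "?P (subpath u v (tail_concat n)) \<in> carrier (pi1 X x0)"
    if "u \<in> {0..1}" "v \<in> {0..1}" "tail_concat n u = b0" "tail_concat n v = b0" for u v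
    using that by (intro push_in_carrier[OF \<sigma> g] subpath_loop) auto
  have e01: "tail_concat k 0 = b0" "tail_concat k 1 = b0" for k
    by (simp_all add: tail_concat_def concat_over_ends)
  have in_carr: "A \<in> carrier (pi1 X x0)" "M \<in> carrier (pi1 X x0)" "B \<in> carrier (pi1 X x0)"
    unfolding A_def M_def B_def using ab at_ends e01 by (auto intro!: carr)
  have Pn: "?P (tail_concat n) = A \<otimes>\<^bsub>pi1 X x0\<^esub> (M \<otimes>\<^bsub>pi1 X x0\<^esub> B)"
    unfolding A_def M_def B_def by (rule push_split[OF \<sigma> g]) (use ab at_ends in auto)
  have "?P (tail_concat (Suc n)) = ?P (subpath 0 (a n) (tail_concat (Suc n))) \<otimes>\<^bsub>pi1 X x0\<^esub>
      (?P (subpath (a n) (b n) (tail_concat (Suc n))) \<otimes>\<^bsub>pi1 X x0\<^esub> ?P (subpath (b n) 1 (tail_concat (Suc n))))"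
    by (rule push_split[OF \<sigma> g]) (use ab at_ends in auto)
  also have "?P (subpath 0 (a n) (tail_concat (Suc n))) = A"
    unfolding A_def
  proof (rule push_ext[OF \<sigma> g])
    fix t :: real assume "t \<in> {0..1}"
    then have "a n * t \<le> a n" using ab by (auto intro: mult_left_le)
    then show "subpath 0 (a n) (tail_concat (Suc n)) t = subpath 0 (a n) (tail_concat n) t"
      by (simp add: subpath_def out)
  qed
  also have "?P (subpath (a n) (b n) (tail_concat (Suc n))) = ?P (\<lambda>t. b0)"
  proof (rule push_ext[OF \<sigma> g])
    fix t :: real assume t: "t \<in> {0..1}"
    then have "0 \<le> (b n - a n) * t" "(b n - a n) * t \<le> b n - a n" using ab by (auto intro: mult_left_le)
    then show "subpath (a n) (b n) (tail_concat (Suc n)) t = b0"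
      by (simp add: subpath_def inside)
  qed
  also have "?P (\<lambda>t. b0) = \<one>\<^bsub>pi1 X x0\<^esub>" by (rule push_const[where g = g, OF \<sigma> g])
  also have "?P (subpath (b n) 1 (tail_concat (Suc n))) = B"
    unfolding B_def
  proof (rule push_ext[OF \<sigma> g])
    fix t :: real assume "t \<in> {0..1}"
    then have "0 \<le> (1 - b n) * t" using ab by auto
    then show "subpath (b n) 1 (tail_concat (Suc n)) t = subpath (b n) 1 (tail_concat n) t"
      by (simp add: subpath_def out)
  qed
  finally have PSn: "?P (tail_concat (Suc n)) = A \<otimes>\<^bsub>pi1 X x0\<^esub> B" using in_carr by (simp add: o_def)
  have "M = ?P (ell n)"
    unfolding M_def
  proof (rule push_ext[OF \<sigma> g])
    fix t :: real assume t: "t \<in> {0..1}"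
    then have "0 \<le> (b n - a n) * t" "(b n - a n) * t \<le> b n - a n" using ab by (auto intro: mult_left_le)
    then have le: "a n \<le> (b n - a n) * t + a n" "(b n - a n) * t + a n \<le> b n" by linarith+
    show "subpath (a n) (b n) (tail_concat n) t = ell n t"
      using ab inside[OF le, of n] by (simp add: subpath_def)
  qed
  then have "M \<in> H" using gen by simp
  have "?P (tail_concat n +++ reversepath (tail_concat (Suc n)))
      = (A \<otimes>\<^bsub>pi1 X x0\<^esub> (M \<otimes>\<^bsub>pi1 X x0\<^esub> B)) \<otimes>\<^bsub>pi1 X x0\<^esub> inv\<^bsub>pi1 X x0\<^esub> (A \<otimes>\<^bsub>pi1 X x0\<^esub> B)"
    by (simp add: push_join[OF \<sigma> g] push_reversepath[OF \<sigma> g] loops_at_reversepath Pn PSn)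
  also have "\<dots> = A \<otimes>\<^bsub>pi1 X x0\<^esub> M \<otimes>\<^bsub>pi1 X x0\<^esub> inv\<^bsub>pi1 X x0\<^esub> A"
    using in_carr by (simp add: H.inv_mult_group H.m_assoc H.inv_solve_left) (simp flip: H.m_assoc)
  also have "\<dots> \<in> H" by (rule H.inv_op_closed2[OF in_carr(1) \<open>M \<in> H\<close>])
  finally show ?thesis .
qed

end

lemma Ctau_closed_if_Cinf_closed:
  assumes normal: "H \<lhd> pi1 X x0" and H: "Cinf_closed X x0 H"
  shows "Ctau_closed X x0 H"
  unfolding c_tau_def test_closed_iff[OF ell_tau_loop]
proof (intro conjI allI impI)
  show sub: "subgroup H (pi1 X x0)" using H by (simp add: test_closed_def)
  fix \<sigma> g
  assume \<sigma>: "\<sigma> \<in> paths_in X x0 (g b0)" and g: "continuous_on earring g" "g \<in> earring \<rightarrow> X"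
    and gens: "\<forall>n\<ge>1. conj_class X \<sigma> (g \<circ> ell n) \<in> H"
  obtain a b where G: "gap_family a b"
    and tau: "\<And>t. t \<in> {0..1} \<Longrightarrow> ell_tau t = gap_family.concat_over a b ell b0 t"
    by (rule ell_tau_gaps) blast
  interpret G: gap_family a b by (rule G)
  define \<gamma> where "\<gamma> n = G.tail_concat n +++ reversepath (G.tail_concat (Suc n))" for n
  have \<gamma>_loop: "\<gamma> n \<in> loops_at earring b0" for n
    unfolding \<gamma>_def by (intro loops_at_join loops_at_reversepath G.tail_concat_loop)
  have \<gamma>_null: "finite {n. 1 \<le> n \<and> \<not> path_image (\<gamma> n) \<subseteq> U}" if U: "open U" "b0 \<in> U" for U
  proof (rule finite_subset)
    let ?bad = "{n. 1 \<le> n \<and> \<not> path_image (G.tail_concat n) \<subseteq> U}"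
    show "finite (?bad \<union> Suc -` ?bad)"
      by (intro finite_UnI finite_vimageI G.tail_concat_null[OF U] inj_Suc)
    have "path_image (\<gamma> n) \<subseteq> path_image (G.tail_concat n) \<union> path_image (G.tail_concat (Suc n))" for n
      unfolding \<gamma>_def using path_image_join_subset[of "G.tail_concat n" "reversepath (G.tail_concat (Suc n))"] by simp
    then show "{n. 1 \<le> n \<and> \<not> path_image (\<gamma> n) \<subseteq> U} \<subseteq> ?bad \<union> Suc -` ?bad" by fastforce
  qed
  obtain F where F: "continuous_on earring F" "F \<in> earring \<rightarrow> earring" "F b0 = b0"
    "\<And>n t. 1 \<le> n \<Longrightarrow> t \<in> {0..1} \<Longrightarrow> F (ell n t) = \<gamma> n t"
    by (rule earring_self_map_exists[of \<gamma>, OF \<gamma>_loop \<gamma>_null]) blast+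
  have "conj_class X \<sigma> ((g \<circ> F) \<circ> ell n) \<in> H" if n: "1 \<le> n" for n
  proof -
    have "conj_class X \<sigma> ((g \<circ> F) \<circ> ell n) = conj_class X \<sigma> (g \<circ> \<gamma> n)"
      by (rule conj_class_ext) (use F(4)[OF n] in auto)
    also have "\<dots> \<in> H"
      unfolding \<gamma>_def by (rule G.tail_concat_step[OF \<sigma> g normal n]) (use gens n in blast)
    finally show ?thesis .
  qed
  moreover have "continuous_on earring (g \<circ> F)"
    using F g by (intro continuous_on_compose) (auto intro: continuous_on_subset)
  moreover have "g \<circ> F \<in> earring \<rightarrow> X" using g F by auto
  moreover have "\<sigma> \<in> paths_in X x0 ((g \<circ> F) b0)" using \<sigma> F by simp
  ultimately have in_H: "conj_class X \<sigma> ((g \<circ> F) \<circ> ell_inf) \<in> H"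
    using H unfolding c_inf_def test_closed_iff[OF ell_inf_loop] by blast
  have hom: "homotopic_paths earring (harm.concat_over \<gamma> b0) (G.tail_concat 1)"
    unfolding \<gamma>_def by (rule telescoping_product[OF G.tail_concat_loop b0_in_earring G.tail_concat_null])
  have "conj_class X \<sigma> ((g \<circ> F) \<circ> ell_inf) = conj_class X \<sigma> (g \<circ> harm.concat_over \<gamma> b0)"
  proof (rule conj_class_ext)
    show "((g \<circ> F) \<circ> ell_inf) t = (g \<circ> harm.concat_over \<gamma> b0) t" if "t \<in> {0..1}" for t
    proof -
      have "F (harm.concat_over ell b0 t) = harm.concat_over \<gamma> b0 t"
        by (rule harm.compose_concat_over[where F = F, OF F(4) F(3)])
      then show ?thesis by (simp add: ell_inf_eq[OF that])
    qed
  qed simp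
  also have "\<dots> = conj_class X \<sigma> (g \<circ> G.tail_concat 1)"
    by (rule push_cong[OF \<sigma> g hom harm.concat_over_loop[OF \<gamma>_loop b0_in_earring \<gamma>_null]])
  also have "\<dots> = conj_class X \<sigma> (g \<circ> ell_tau)"
  proof (rule conj_class_ext)
    show "(g \<circ> G.tail_concat 1) t = (g \<circ> ell_tau) t" if "t \<in> {0..1}" for t
    proof (cases "\<exists>n\<ge>1. a n < t \<and> t < b n")
      case True
      then obtain n where n: "1 \<le> n" "a n < t" "t < b n" by blast
      then show ?thesis by (simp add: tau[OF that] G.tail_concat_def G.concat_over_open[OF n])
    next
      case False
      then show ?thesis by (simp add: tau[OF that] G.tail_concat_def G.concat_over_outside)
    qed
  qed simp
  finally show "conj_class X \<sigma> (g \<circ> ell_tau) \<in> H" using in_H by simp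
qed

section \<open>The comparison of the two closure operators\<close>

theorem proposition3p8:
  fixes X :: "'a::topological_space set" and x0 :: 'a
  assumes "path_connected X" and "x0 \<in> X"
  shows "(\<forall>H. subgroup H (pi1 X x0) \<longrightarrow> Ctau_closed X x0 H \<longrightarrow> Cinf_closed X x0 H) \<and>
         (\<forall>H. H \<lhd> pi1 X x0 \<longrightarrow> Cinf_closed X x0 H \<longrightarrow> Ctau_closed X x0 H) \<and>
         (\<forall>N. N \<lhd> pi1 X x0 \<longrightarrow> cl_Cinf X x0 N = cl_Ctau X x0 N)"
proof (intro conjI allI impI)
  note x0 = assms(2)
  show "Cinf_closed X x0 H" if "Ctau_closed X x0 H" for H
    by (rule Cinf_closed_if_Ctau_closed[OF that])
  show "Ctau_closed X x0 H" if "H \<lhd> pi1 X x0" "Cinf_closed X x0 H" for H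
    by (rule Ctau_closed_if_Cinf_closed[OF that])
  fix N assume N: "N \<lhd> pi1 X x0"
  show "cl_Cinf X x0 N = cl_Ctau X x0 N"
  proof
    show "cl_Cinf X x0 N \<subseteq> cl_Ctau X x0 N"
      unfolding test_closure_def using Cinf_closed_if_Ctau_closed[where X = X and ?x0.0 = x0] by blast
    have "N \<subseteq> carrier (pi1 X x0)" using N normal_imp_subgroup subgroup.subset by blast
    then have "Cinf_closed X x0 (cl_Cinf X x0 N)"
      unfolding c_inf_def by (rule test_closed_closure[OF x0 ell_inf_loop])
    moreover have "cl_Cinf X x0 N \<lhd> pi1 X x0"
      unfolding c_inf_def by (rule test_closure_normal[OF x0 ell_inf_loop N])
    ultimately have "Ctau_closed X x0 (cl_Cinf X x0 N)" by (intro Ctau_closed_if_Cinf_closed)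
    moreover have "N \<subseteq> cl_Cinf X x0 N" by (auto simp: test_closure_def)
    ultimately show "cl_Ctau X x0 N \<subseteq> cl_Cinf X x0 N" unfolding test_closure_def[of _ _ _ c_tau] by blast
  qed
qed

end
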